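(* Let $\mathbf{R}=k[x,y]$ be a polynomial ring over a field $k$, let $n\ge2$, and let $I=(f_1,f_2,f_3)$ be a codimension $2$ ideal generated by the $2\times2$ minors of a $3\times2$ matrix $\varphi$ with homogeneous entries whose two columns $\alpha$ and $\beta$ have entries of degrees $\deg\alpha=1$ and $\deg\beta=n-1$ respectively, so that the $f_i$ are forms of degree $n$. Assume that $f_1,f_2$ is a regular sequence, put $J=(f_1,f_2)$, and let $F_j=I^j/JI^{j-1}$. Then $\lambda(F_j)=n-j$ for $1\le j\le n-1$. In particular, $\mathbf{R}[It]$ is almost Cohen--Macaulay.
   Context: $\lambda$ denotes length. $\mathbf{R}[It]$ is the Rees algebra of $I$; it is almost Cohen--Macaulay if $\operatorname{depth}\mathbf{R}[It]\ge 2=\dim\mathbf{R}$, depth taken with respect to the maximal homogeneous ideal $(x,y,It)$. *)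

theory Defs
  imports
    "HOL-Analysis.Determinants"
    "HOL-Algebra.Ideal_Product"
    "HOL-Algebra.Module"
    "HOL-Algebra.Algebraic_Closure_Type"
    "HOL-Library.Extended_Nat"
begin

section \<open>Commutative algebra over HOL-Algebra rings\<close>

text \<open>Height (codimension) of an ideal: the minimal height of a prime containing it, the height
  of a prime being the supremum of the lengths of chains of primes ending in it.\<close>

definition prime_height :: "('a, 'b) ring_scheme \<Rightarrow> 'a set \<Rightarrow> enat" where
  "prime_height R P =
     Sup {enat n |n. \<exists>C :: nat \<Rightarrow> 'a set.
            (\<forall>i\<le>n. primeideal (C i) R) \<and> (\<forall>i<n. C i \<subset> C (Suc i)) \<and> C n = P}"

definition ideal_codim :: "('a, 'b) ring_scheme \<Rightarrow> 'a set \<Rightarrow> enat" where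
  "ideal_codim R I = Inf {prime_height R P |P. primeideal P R \<and> I \<subseteq> P}"

text \<open>Each \<open>fs ! i\<close> is a nonzerodivisor modulo the ideal generated by its predecessors,
  and the ideal generated by the whole sequence is proper.\<close>

definition regular_sequence :: "('a, 'b) ring_scheme \<Rightarrow> 'a list \<Rightarrow> bool" where
  "regular_sequence R fs \<longleftrightarrow>
     set fs \<subseteq> carrier R \<and>
     (\<forall>i<length fs. \<forall>a\<in>carrier R.
        fs ! i \<otimes>\<^bsub>R\<^esub> a \<in> Idl\<^bsub>R\<^esub> (set (take i fs)) \<longrightarrow> a \<in> Idl\<^bsub>R\<^esub> (set (take i fs))) \<and>
     Idl\<^bsub>R\<^esub> (set fs) \<noteq> carrier R"

definition depth_wrt :: "('a, 'b) ring_scheme \<Rightarrow> 'a set \<Rightarrow> enat" where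
  "depth_wrt R M = Sup {enat (length fs) |fs. regular_sequence R fs \<and> set fs \<subseteq> M}"

definition module_length :: "('a, 'c) ring_scheme \<Rightarrow> ('a, 'b, 'd) module_scheme \<Rightarrow> enat" where
  "module_length R M =
     Sup {enat n |n. \<exists>C :: nat \<Rightarrow> 'b set.
            (\<forall>i\<le>n. submodule (C i) R M) \<and> (\<forall>i<n. C i \<subset> C (Suc i))}"

definition ideal_as_module :: "('a, 'b) ring_scheme \<Rightarrow> 'a set \<Rightarrow> ('a, 'a) module" where
  "ideal_as_module R I =
     \<lparr>carrier = I, mult = (\<otimes>\<^bsub>R\<^esub>), one = \<one>\<^bsub>R\<^esub>, zero = \<zero>\<^bsub>R\<^esub>, add = (\<oplus>\<^bsub>R\<^esub>),
      module.smult = (\<otimes>\<^bsub>R\<^esub>)\<rparr>"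

text \<open>The quotient module \<open>M / N\<close>; its elements are the additive cosets of \<open>N\<close>. The record fields
  \<open>mult\<close> and \<open>one\<close> play no role in a module.\<close>

definition quotient_module ::
    "('a, 'b, 'd) module_scheme \<Rightarrow> 'b set \<Rightarrow> ('a, 'b set) module" where
  "quotient_module M N =
     \<lparr>carrier = a_rcosets\<^bsub>M\<^esub> N, mult = undefined, one = undefined,
      zero = N, add = (<+>\<^bsub>M\<^esub>),
      module.smult = (\<lambda>r S. \<Union>x\<in>S. N +>\<^bsub>M\<^esub> (r \<odot>\<^bsub>M\<^esub> x))\<rparr>"

abbreviation ideal_power :: "('a, 'b) ring_scheme \<Rightarrow> 'a set \<Rightarrow> nat \<Rightarrow> 'a set" where
  "ideal_power R I j \<equiv> I [^]\<^bsub>ideals_set R\<^esub> j"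


section \<open>The ring \<open>k[x,y]\<close> and Rees algebras\<close>

text \<open>\<open>k[x,y]\<close> is \<open>'k poly poly\<close>: the inner variable is \<open>x\<close>, the outer one \<open>y\<close>.\<close>

abbreviation Rxy :: "'k::field poly poly ring" where
  "Rxy \<equiv> ring_of_type_algebra"

definition var_x :: "'k::field poly poly" where
  "var_x = [:[:0, 1:]:]"

definition var_y :: "'k::field poly poly" where
  "var_y = [:0, 1:]"

text \<open>As usual, the zero polynomial counts as a form of every degree.\<close>

definition is_form :: "nat \<Rightarrow> 'k::field poly poly \<Rightarrow> bool" where
  "is_form d p \<longleftrightarrow> (\<forall>i j. poly.coeff (poly.coeff p j) i \<noteq> 0 \<longrightarrow> i + j = d)"

definition row_minor :: "'a::comm_ring_1^2^3 \<Rightarrow> 3 \<Rightarrow> 3 \<Rightarrow> 'a" where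
  "row_minor \<phi> i j = det (vector [\<phi> $ i, \<phi> $ j] :: 'a^2^2)"

text \<open>\<open>R[It] = \<Oplus>\<^sub>i I\<^sup>i t\<^sup>i\<close> as a subring of the polynomial ring \<open>R[t]\<close>.\<close>

definition rees_algebra :: "'a::comm_ring_1 set \<Rightarrow> 'a poly ring" where
  "rees_algebra I = ring_of_type_algebra
     \<lparr>carrier := {p. \<forall>i. poly.coeff p i \<in> ideal_power ring_of_type_algebra I i}\<rparr>"

text \<open>The maximal homogeneous ideal \<open>(x, y, It)\<close> of \<open>R[It]\<close>, where \<open>R = k[x,y]\<close>.\<close>

definition rees_max_ideal :: "'k::field poly poly set \<Rightarrow> 'k poly poly poly set" where
  "rees_max_ideal I =
     Idl\<^bsub>rees_algebra I\<^esub> ({[:var_x:], [:var_y:]} \<union> {Polynomial.monom a 1 |a. a \<in> I})"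

text \<open>The bound 2 is the dimension of \<open>k[x,y]\<close>.\<close>

definition rees_almost_cohen_macaulay :: "'k::field poly poly set \<Rightarrow> bool" where
  "rees_almost_cohen_macaulay I \<longleftrightarrow> depth_wrt (rees_algebra I) (rees_max_ideal I) \<ge> 2"

end

theory Submission
  imports Defs
begin

text \<open>Write the linear column as \<open>(a\<^sub>1 u + b\<^sub>1 v, a\<^sub>2 u + b\<^sub>2 v, u)\<close> with \<open>u\<close> its third entry and \<open>u, v\<close> a
  basis of the linear forms. Cramer-type elimination yields a form \<open>q\<close> of degree \<open>n - 1\<close> such that
  \<open>J = (p, uq)\<close> and \<open>I = (p, uq, vq)\<close>, where \<open>p\<close> is \<open>f\<^sub>1\<close> or \<open>f\<^sub>2\<close>; thus \<open>I = (p) + q (x, y)\<close>.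
  The module \<open>F\<^sub>j\<close> is generated by \<open>(vq)\<^sup>j\<close>. Its annihilator contains \<open>u\<close>, and also \<open>v\<close> to the power
  \<open>n - j\<close> because \<open>p\<close> is \<open>c v\<^sup>n\<close> modulo \<open>u\<close>, \<open>c \<noteq> 0\<close>. It does not contain \<open>v\<close> to the power \<open>n - j - 1\<close>: since
  \<open>J I\<^bsup>j-1\<^esup> \<subseteq> (p, u q\<^sup>j)\<close> and \<open>p, q\<close> are coprime, this would put \<open>v\<^bsup>n-1\<^esup>\<close> into \<open>(u, p) = (u, v\<^sup>n)\<close>.
  Hence \<open>F\<^sub>j\<close> is uniserial of length \<open>n - j\<close>.

  For the depth, every element of \<open>I\<^bsup>j+1\<^esup>\<close> has the form \<open>p s + q\<^bsup>j+1\<^esup> w\<close> with \<open>s \<in> I\<^sup>j\<close> and \<open>w\<close> of order at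
  least \<open>j + 1\<close>. If it is divisible by \<open>p\<close>, then so is \<open>w\<close>, and comparing orders gives
  \<open>I\<^bsup>j+1\<^esup> : p = I\<^sup>j\<close>. This makes \<open>u, p t\<close> a regular sequence in \<open>R[It]\<close>.\<close>

section \<open>Ideals and lengths of quotients\<close>

lemma ring_of_type_algebra_simps [simp]:
  "carrier (ring_of_type_algebra :: 'a::comm_ring_1 ring) = UNIV"
  "mult (ring_of_type_algebra :: 'a::comm_ring_1 ring) = (*)"
  "add (ring_of_type_algebra :: 'a::comm_ring_1 ring) = (+)"
  "one (ring_of_type_algebra :: 'a::comm_ring_1 ring) = 1"
  "zero (ring_of_type_algebra :: 'a::comm_ring_1 ring) = 0"
  by (simp_all add: ring_of_type_algebra_def)

text \<open>Negation is multiplication by \<open>- 1\<close>, so the additive subgroup condition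
  follows from closure under sums and multiples. Ideal arguments can then use the type class
  operations.\<close>

lemma ideal_ring_of_type_algebra_iff:
  "ideal A (ring_of_type_algebra :: 'a::comm_ring_1 ring) \<longleftrightarrow>
     0 \<in> A \<and> (\<forall>a\<in>A. \<forall>b\<in>A. a + b \<in> A) \<and> (\<forall>r. \<forall>a\<in>A. r * a \<in> A)"
    (is "ideal A ?R \<longleftrightarrow> ?rhs")
proof
  interpret R: ring ?R by (rule ring_from_type_algebra)
  show ?rhs if "ideal A ?R"
  proof -
    interpret ideal A ?R by fact
    show ?thesis
      using zero_closed a_closed I_l_closed by auto
  qed
  show "ideal A ?R" if rhs: ?rhs
  proof (rule idealI[OF R.ring_axioms])
    have inv: "inv\<^bsub>add_monoid ?R\<^esub> a = - a" for a :: 'a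
      using R.minus_equality[of "- a" a] by (simp add: a_inv_def)
    have "- a \<in> A" if "a \<in> A" for a
    proof -
      have "(- 1) * a \<in> A" using rhs that by blast
      then show ?thesis by simp
    qed
    then show "subgroup A (add_monoid ?R)"
      using rhs by unfold_locales (auto simp: inv[simplified])
  next
    show "r \<otimes>\<^bsub>?R\<^esub> a \<in> A" "a \<otimes>\<^bsub>?R\<^esub> r \<in> A" if "a \<in> A" for a r
      using rhs that by (simp_all add: mult.commute[of a r])
  qed
qed

lemma genideal_empty: "Idl\<^bsub>ring_of_type_algebra\<^esub> {} = {0 :: 'a::comm_ring_1}"
proof -
  have "ideal {0 :: 'a} ring_of_type_algebra"
    by (simp add: ideal_ring_of_type_algebra_iff)
  moreover have "0 \<in> A" if "ideal A ring_of_type_algebra" for A :: "'a set"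
    using that by (simp add: ideal_ring_of_type_algebra_iff)
  ultimately show ?thesis
    unfolding genideal_def by blast
qed

lemma ideal_genideal: "ideal (Idl\<^bsub>ring_of_type_algebra\<^esub> S) (ring_of_type_algebra :: 'a::comm_ring_1 ring)"
  by (rule ring.genideal_ideal[OF ring_from_type_algebra]) simp

lemma genideal_superset:
  "S \<subseteq> Idl\<^bsub>ring_of_type_algebra\<^esub> (S :: 'a::comm_ring_1 set)"
  by (auto simp: genideal_def)

lemma genideal_least:
  assumes "S \<subseteq> A" "ideal A (ring_of_type_algebra :: 'a::comm_ring_1 ring)"
  shows "Idl\<^bsub>ring_of_type_algebra\<^esub> S \<subseteq> A"
  using assms by (auto simp: genideal_def)

text \<open>The right-hand side describes an ideal containing all generators. Used repeatedly, it
  peels off one generator at a time until a linear combination is left.\<close>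

lemma mem_genideal_insert:
  fixes a :: "'a::comm_ring_1"
  shows "z \<in> Idl\<^bsub>ring_of_type_algebra\<^esub> (insert a S) \<longleftrightarrow>
    (\<exists>r. \<exists>s\<in>Idl\<^bsub>ring_of_type_algebra\<^esub> S. z = a * r + s)"
    (is "_ \<longleftrightarrow> ?P z")
proof
  let ?R = "ring_of_type_algebra :: 'a ring"
  note S = ideal_genideal[of S, unfolded ideal_ring_of_type_algebra_iff]
  have "ideal {z. ?P z} ?R"
    unfolding ideal_ring_of_type_algebra_iff
  proof safe
    show "?P 0" using S by (intro exI[of _ 0] bexI[of _ 0]) auto
    fix r s r' s' assume "s \<in> Idl\<^bsub>?R\<^esub> S" "s' \<in> Idl\<^bsub>?R\<^esub> S"
    then show "?P (a * r + s + (a * r' + s'))"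
      using S by (intro exI[of _ "r + r'"] bexI[of _ "s + s'"]) (auto simp: algebra_simps)
  next
    fix r r' s assume "s \<in> Idl\<^bsub>?R\<^esub> S"
    then show "?P (r * (a * r' + s))"
      using S by (intro exI[of _ "r * r'"] bexI[of _ "r * s"]) (auto simp: algebra_simps)
  qed
  moreover have "insert a S \<subseteq> {z. ?P z}"
  proof safe
    show "?P a" using S by (intro exI[of _ 1] bexI[of _ 0]) auto
    show "?P s" if "s \<in> S" for s
      using that genideal_superset[of S] by (intro exI[of _ 0] bexI[of _ s]) auto
  qed
  ultimately show "z \<in> Idl\<^bsub>?R\<^esub> (insert a S) \<Longrightarrow> ?P z"
    using genideal_least by blast
  have "Idl\<^bsub>?R\<^esub> S \<subseteq> Idl\<^bsub>?R\<^esub> (insert a S)"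
    using genideal_least[OF _ ideal_genideal] genideal_superset[of "insert a S"] by blast
  moreover have "a \<in> Idl\<^bsub>?R\<^esub> (insert a S)"
    using genideal_superset[of "insert a S"] by blast
  ultimately show "?P z \<Longrightarrow> z \<in> Idl\<^bsub>?R\<^esub> (insert a S)"
    using ideal_genideal[of "insert a S", unfolded ideal_ring_of_type_algebra_iff]
    by (auto simp: mult.commute)
qed

lemma ideal_add: "ideal A ring_of_type_algebra \<Longrightarrow> a \<in> A \<Longrightarrow> b \<in> A \<Longrightarrow> a + b \<in> A"
  and ideal_mult: "ideal A ring_of_type_algebra \<Longrightarrow> a \<in> A \<Longrightarrow> r * a \<in> A"
  and ideal_diff: "ideal A ring_of_type_algebra \<Longrightarrow> a \<in> A \<Longrightarrow> b \<in> A \<Longrightarrow> a - b \<in> A"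
  for A :: "'a::comm_ring_1 set"
proof -
  show add: "ideal A ring_of_type_algebra \<Longrightarrow> a \<in> A \<Longrightarrow> b \<in> A \<Longrightarrow> a + b \<in> A" for a b
    by (simp add: ideal_ring_of_type_algebra_iff)
  show mul: "ideal A ring_of_type_algebra \<Longrightarrow> a \<in> A \<Longrightarrow> r * a \<in> A" for r a
    by (simp add: ideal_ring_of_type_algebra_iff)
  show "ideal A ring_of_type_algebra \<Longrightarrow> a \<in> A \<Longrightarrow> b \<in> A \<Longrightarrow> a - b \<in> A"
    using add[of a "(- 1) * b"] mul[of b "- 1"] by simp
qed

lemma mem_genideal_singleton:
  fixes a :: "'a::comm_ring_1"
  shows "z \<in> Idl\<^bsub>ring_of_type_algebra\<^esub> {a} \<longleftrightarrow> (\<exists>r. z = a * r)"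
  by (simp add: mem_genideal_insert genideal_empty)

section \<open>Products and powers of ideals\<close>

lemma ideal_ideal_prod:
  fixes A B :: "'a::comm_ring_1 set"
  assumes "ideal A ring_of_type_algebra" "ideal B ring_of_type_algebra"
  shows "ideal (A \<cdot>\<^bsub>ring_of_type_algebra\<^esub> B) ring_of_type_algebra"
  by (rule ring.ideal_prod_is_ideal[OF ring_from_type_algebra assms])

lemma ideal_prod_least:
  fixes A B C :: "'a::comm_ring_1 set"
  assumes "ideal C ring_of_type_algebra" "\<And>a b. a \<in> A \<Longrightarrow> b \<in> B \<Longrightarrow> a * b \<in> C"
  shows "A \<cdot>\<^bsub>ring_of_type_algebra\<^esub> B \<subseteq> C"
proof
  fix z assume "z \<in> A \<cdot>\<^bsub>ring_of_type_algebra\<^esub> B"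
  then show "z \<in> C"
    by induction (use assms in \<open>auto simp: ideal_ring_of_type_algebra_iff\<close>)
qed

lemma ideal_prodI:
  fixes A B :: "'a::comm_ring_1 set"
  shows "a \<in> A \<Longrightarrow> b \<in> B \<Longrightarrow> a * b \<in> A \<cdot>\<^bsub>ring_of_type_algebra\<^esub> B"
  using ideal_prod.prod[of a A b B ring_of_type_algebra] by simp

lemma ideals_set_simps [simp]:
  "one (ideals_set (ring_of_type_algebra :: 'a::comm_ring_1 ring)) = UNIV"
  "mult (ideals_set (ring_of_type_algebra :: 'a::comm_ring_1 ring)) = ideal_prod ring_of_type_algebra"
  by (simp_all add: ideals_set_def)

lemma ideal_power_simps [simp]:
  fixes A :: "'a::comm_ring_1 set"
  shows "ideal_power ring_of_type_algebra A 0 = UNIV"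
    "ideal_power ring_of_type_algebra A (Suc k) =
       ideal_power ring_of_type_algebra A k \<cdot>\<^bsub>ring_of_type_algebra\<^esub> A"
  by (simp_all add: nat_pow_def)

lemma ideal_ideal_power:
  fixes A :: "'a::comm_ring_1 set"
  assumes "ideal A ring_of_type_algebra"
  shows "ideal (ideal_power ring_of_type_algebra A k) ring_of_type_algebra"
  by (induction k) (simp add: ideal_ring_of_type_algebra_iff, simp add: ideal_ideal_prod assms)

text \<open>The elements \<open>b\<close> with \<open>a * b\<close> in the target power form an
  ideal, so the inductive step only has to treat products. This makes the Rees algebra closed under
  multiplication.\<close>

lemma ideal_power_mult:
  fixes A :: "'a::comm_ring_1 set"
  assumes A: "ideal A ring_of_type_algebra"
    and "a \<in> ideal_power ring_of_type_algebra A i" "b \<in> ideal_power ring_of_type_algebra A j"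
  shows "a * b \<in> ideal_power ring_of_type_algebra A (i + j)"
  using assms(2,3)
proof (induction j arbitrary: b)
  case 0
  then show ?case
    using ideal_ideal_power[OF A, of i] by (simp add: ideal_ring_of_type_algebra_iff mult.commute[of a b])
next
  case (Suc j)
  let ?C = "{b. a * b \<in> ideal_power ring_of_type_algebra A (i + Suc j)}"
  have "ideal ?C ring_of_type_algebra"
    using ideal_ideal_power[OF A, of "i + Suc j"]
    by (simp add: ideal_ring_of_type_algebra_iff distrib_left mult.left_commute del: ideal_power_simps)
  moreover have "b * c \<in> ?C" if "b \<in> ideal_power ring_of_type_algebra A j" "c \<in> A" for b c
    using ideal_prodI[OF Suc.IH[OF Suc.prems(1) that(1)] that(2)] by (simp add: mult.assoc)
  ultimately have "ideal_power ring_of_type_algebra A (Suc j) \<subseteq> ?C"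
    unfolding ideal_power_simps by (rule ideal_prod_least)
  then show ?case using Suc.prems(2) by blast
qed

section \<open>Quotients of ideals and their length\<close>

text \<open>The correspondence theorem, by images and preimages under the coset map
  \<open>Q\<close>. The coset operations are computed directly, without first showing that the
  quotient is a module.\<close>

lemma submodule_quotient_iff:
  fixes A N :: "'a::comm_ring_1 set"
  assumes A: "ideal A ring_of_type_algebra" and N: "ideal N ring_of_type_algebra" and NA: "N \<subseteq> A"
  shows "submodule C ring_of_type_algebra (quotient_module (ideal_as_module ring_of_type_algebra A) N) \<longleftrightarrow>
    (\<exists>B. ideal B ring_of_type_algebra \<and> N \<subseteq> B \<and> B \<subseteq> A \<and> C = (\<lambda>a. {z. z - a \<in> N}) ` B)"
proof -
  let ?R = "ring_of_type_algebra :: 'a ring"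
  define Q where "Q = (\<lambda>a. {z. z - a \<in> N})"
  define F where "F = quotient_module (ideal_as_module ?R A) N"
  note A' = A[unfolded ideal_ring_of_type_algebra_iff] and N' = N[unfolded ideal_ring_of_type_algebra_iff]
  have Nneg: "- a \<in> N" if "a \<in> N" for a
    using N' that by (metis mult_minus1)
  have Ndiff: "a - b \<in> N" if "a \<in> N" "b \<in> N" for a b
    using N' Nneg that by (metis add_uminus_conv_diff)
  have coset: "N +>\<^bsub>ideal_as_module ?R A\<^esub> a = Q a" for a
    unfolding a_r_coset_def r_coset_def Q_def ideal_as_module_def
    by (auto intro!: bexI[of _ "_ - a"])
  have Q_eq: "Q a = Q b \<longleftrightarrow> a - b \<in> N" for a b
  proof
    assume "Q a = Q b"
    moreover have "a \<in> Q a" using N' by (simp add: Q_def)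
    ultimately show "a - b \<in> N" by (simp add: Q_def)
  next
    assume ab: "a - b \<in> N"
    have "z - a \<in> N \<longleftrightarrow> z - b \<in> N" for z
    proof
      show "z - b \<in> N" if "z - a \<in> N"
        using N' ab that by (metis add.commute diff_add_cancel add_diff_eq)
      show "z - a \<in> N" if "z - b \<in> N"
        using Ndiff[OF that ab] by simp
    qed
    then show "Q a = Q b" by (simp add: Q_def)
  qed
  have Q_self: "a \<in> Q a" for a using N' by (simp add: Q_def)
  have Q0: "Q 0 = N" by (simp add: Q_def)
  have mem_Q: "z \<in> Q a \<longleftrightarrow> Q z = Q a" for z a by (simp add: Q_eq) (simp add: Q_def)
  have carrier: "carrier F = Q ` A"
    by (auto simp: F_def quotient_module_def A_RCOSETS_def RCOSETS_def coset[unfolded a_r_coset_def])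
      (auto simp: ideal_as_module_def)
  have zero: "zero F = Q 0"
    by (simp add: F_def quotient_module_def Q0)
  have add: "Q a \<oplus>\<^bsub>F\<^esub> Q b = Q (a + b)" for a b
  proof -
    have "Q a \<oplus>\<^bsub>F\<^esub> Q b = (\<Union>x\<in>Q a. \<Union>y\<in>Q b. {x + y})"
      by (simp add: F_def quotient_module_def set_add_def set_mult_def ideal_as_module_def)
    also have "\<dots> = Q (a + b)"
    proof safe
      fix x y assume "x \<in> Q a" "y \<in> Q b"
      then have "(x - a) + (y - b) \<in> N" using N' by (simp add: Q_def)
      then show "x + y \<in> Q (a + b)" by (simp add: Q_def algebra_simps)
    next
      fix z assume "z \<in> Q (a + b)"
      then have "z - b \<in> Q a" by (simp add: Q_def algebra_simps)
      then show "z \<in> (\<Union>x\<in>Q a. \<Union>y\<in>Q b. {x + y})"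
        using Q_self[of b] by (intro UN_I[of "z - b"] UN_I[of b]) auto
    qed
    finally show ?thesis .
  qed
  have smult: "r \<odot>\<^bsub>F\<^esub> Q a = Q (r * a)" for r a
  proof -
    have "r \<odot>\<^bsub>F\<^esub> Q a = (\<Union>x\<in>Q a. N +>\<^bsub>ideal_as_module ?R A\<^esub> (r * x))"
      by (simp add: F_def quotient_module_def) (simp add: ideal_as_module_def)
    also have "\<dots> = (\<Union>x\<in>Q a. Q (r * x))" by (simp only: coset)
    also have "\<dots> = Q (r * a)"
    proof -
      have "Q (r * x) = Q (r * a)" if "x \<in> Q a" for x
      proof -
        have "r * (x - a) \<in> N" using that N' by (simp add: Q_def)
        then show ?thesis by (simp add: Q_eq algebra_simps)
      qed
      then show ?thesis using Q_self[of a] by blast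
    qed
    finally show ?thesis .
  qed
  have A_neg: "- a \<in> A" if "a \<in> A" for a
    using A' that by (metis mult_minus1)
  have inv: "inv\<^bsub>add_monoid F\<^esub> (Q a) = Q (- a)" if "a \<in> A" for a
  proof -
    \<comment> \<open>Inverses in a monoid record are definite descriptions. As no group structure
      on \<open>F\<close> is available, the description is evaluated by exhibiting its unique
      solution.\<close>
    have "(THE y. y \<in> Q ` A \<and> Q a \<oplus>\<^bsub>F\<^esub> y = Q 0 \<and> y \<oplus>\<^bsub>F\<^esub> Q a = Q 0) = Q (- a)"
    proof (rule the_equality)
      show "Q (- a) \<in> Q ` A \<and> Q a \<oplus>\<^bsub>F\<^esub> Q (- a) = Q 0 \<and> Q (- a) \<oplus>\<^bsub>F\<^esub> Q a = Q 0"
        using A_neg that by (simp add: add)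
      fix y assume "y \<in> Q ` A \<and> Q a \<oplus>\<^bsub>F\<^esub> y = Q 0 \<and> y \<oplus>\<^bsub>F\<^esub> Q a = Q 0"
      then obtain x where "y = Q x" "Q (a + x) = Q 0" by (auto simp: add)
      then show "y = Q (- a)" by (simp add: Q_eq add.commute)
    qed
    then show ?thesis
      by (simp add: m_inv_def carrier zero)
  qed
  have "submodule C ?R F \<longleftrightarrow> (\<exists>B. ideal B ?R \<and> N \<subseteq> B \<and> B \<subseteq> A \<and> C = Q ` B)"
  proof
    assume C: "submodule C ?R F"
    note sg = submodule.axioms(1)[OF C] and sm = submodule.smult_closed[OF C]
    have sub: "C \<subseteq> Q ` A" using subgroup.subset[OF sg] by (simp add: carrier)
    have zeroC: "Q 0 \<in> C" using subgroup.one_closed[OF sg] by (simp add: zero)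
    have addC: "S \<oplus>\<^bsub>F\<^esub> T \<in> C" if "S \<in> C" "T \<in> C" for S T
      using subgroup.m_closed[OF sg] that by simp
    have smC: "r \<odot>\<^bsub>F\<^esub> S \<in> C" if "S \<in> C" for r S
      using sm that by simp
    define B where "B = {a \<in> A. Q a \<in> C}"
    have "ideal B ?R"
      unfolding ideal_ring_of_type_algebra_iff B_def
      using A' zeroC addC smC by (auto simp flip: add smult)
    moreover have "N \<subseteq> B"
    proof
      fix a assume "a \<in> N"
      then have "Q a = Q 0" by (simp add: Q_eq)
      then show "a \<in> B" using zeroC NA \<open>a \<in> N\<close> by (auto simp: B_def)
    qed
    moreover have "B \<subseteq> A" "C = Q ` B" using sub by (auto simp: B_def)
    ultimately show "\<exists>B. ideal B ?R \<and> N \<subseteq> B \<and> B \<subseteq> A \<and> C = Q ` B" by blast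
  next
    assume "\<exists>B. ideal B ?R \<and> N \<subseteq> B \<and> B \<subseteq> A \<and> C = Q ` B"
    then obtain B where B: "ideal B ?R" "N \<subseteq> B" "B \<subseteq> A" "C = Q ` B" by blast
    note B' = B(1)[unfolded ideal_ring_of_type_algebra_iff]
    have "- a \<in> B" if "a \<in> B" for a
      using B' that by (metis mult_minus1)
    then show "submodule C ?R F"
      using B' B(3) unfolding B(4)
      by unfold_locales (auto simp: carrier zero add smult inv[simplified carrier zero] subset_iff)
  qed
  then show ?thesis by (simp add: F_def Q_def)
qed

text \<open>Passing to cosets keeps inclusions strict, because an ideal containing \<open>N\<close>
  is the union of its cosets.\<close>

lemma module_length_quotient:
  fixes A N :: "'a::comm_ring_1 set"
  assumes A: "ideal A ring_of_type_algebra" and N: "ideal N ring_of_type_algebra" and NA: "N \<subseteq> A"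
  shows "module_length ring_of_type_algebra (quotient_module (ideal_as_module ring_of_type_algebra A) N) =
    Sup {enat n |n. \<exists>B. (\<forall>i\<le>n. ideal (B i) ring_of_type_algebra \<and> N \<subseteq> B i \<and> B i \<subseteq> A) \<and>
                        (\<forall>i<n. B i \<subset> B (Suc i))}"
proof -
  let ?R = "ring_of_type_algebra :: 'a ring"
  define Q where "Q = (\<lambda>a. {z. z - a \<in> N})"
  let ?I = "\<lambda>B. ideal B ?R \<and> N \<subseteq> B \<and> B \<subseteq> A"
  have sub_iff: "submodule C ?R (quotient_module (ideal_as_module ?R A) N) \<longleftrightarrow> (\<exists>B. ?I B \<and> C = Q ` B)" for C
    using submodule_quotient_iff[OF assms, of C] by (auto simp: Q_def)
  have Un: "\<Union> (Q ` B) = B" if B: "?I B" for B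
  proof
    show "B \<subseteq> \<Union> (Q ` B)"
      using N[unfolded ideal_ring_of_type_algebra_iff] by (auto simp: Q_def)
    show "\<Union> (Q ` B) \<subseteq> B"
    proof safe
      fix z a assume "z \<in> Q a" "a \<in> B"
      then have "(z - a) + a \<in> B"
        using B unfolding Q_def ideal_ring_of_type_algebra_iff by blast
      then show "z \<in> B" by simp
    qed
  qed
  have inj: "Q ` B \<subset> Q ` B' \<longleftrightarrow> B \<subset> B'" if "?I B" "?I B'" for B B'
  proof -
    have "Q ` B \<subseteq> Q ` B' \<longleftrightarrow> B \<subseteq> B'" if "?I B" "?I B'" for B B'
    proof
      assume "Q ` B \<subseteq> Q ` B'"
      then have "\<Union> (Q ` B) \<subseteq> \<Union> (Q ` B')" by (rule Union_mono)
      then show "B \<subseteq> B'" by (simp only: Un[OF that(1)] Un[OF that(2)])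
    qed (rule image_mono)
    from this[OF that] this[OF that(2,1)] show ?thesis by (simp add: less_le_not_le)
  qed
  have "(\<exists>C. (\<forall>i\<le>n. submodule (C i) ?R (quotient_module (ideal_as_module ?R A) N)) \<and>
             (\<forall>i<n. C i \<subset> C (Suc i))) \<longleftrightarrow>
        (\<exists>B. (\<forall>i\<le>n. ?I (B i)) \<and> (\<forall>i<n. B i \<subset> B (Suc i)))" (is "?l \<longleftrightarrow> ?r") for n
  proof
    assume ?l
    then obtain C where C: "\<forall>i\<le>n. \<exists>B. ?I B \<and> C i = Q ` B" "\<forall>i<n. C i \<subset> C (Suc i)"
      unfolding sub_iff by blast
    then obtain B where B: "\<forall>i\<le>n. ?I (B i) \<and> C i = Q ` B i" by metis
    have "B i \<subset> B (Suc i)" if "i < n" for i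
      using inj[of "B i" "B (Suc i)"] B C(2) that by auto
    then show ?r using B by blast
  next
    assume ?r
    then obtain B where B: "\<forall>i\<le>n. ?I (B i)" "\<forall>i<n. B i \<subset> B (Suc i)" by blast
    have "Q ` B i \<subset> Q ` B (Suc i)" if "i < n" for i
      using inj[of "B i" "B (Suc i)"] B that by simp
    moreover have "\<exists>B'. ?I B' \<and> Q ` B i = Q ` B'" if "i \<le> n" for i
      using B(1) that by (intro exI[of _ "B i"]) simp
    ultimately show ?l
      unfolding sub_iff by (intro exI[of _ "\<lambda>i. Q ` B i"]) simp
  qed
  then show ?thesis by (simp add: module_length_def)
qed

text \<open>By \<open>local\<close>, every ring element is zero or a unit modulo
  \<open>(u, v)\<close>. As \<open>u\<close> kills the class of \<open>g\<close>, the submodules of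
  \<open>A / N\<close> are generated by the classes of \<open>v ^ k * g\<close>, with
  \<open>k\<close> between 0 and \<open>m\<close>.\<close>

lemma module_length_cyclic_quotient:
  fixes A N :: "'a::comm_ring_1 set" and g u v :: 'a
  assumes A: "ideal A ring_of_type_algebra" and N: "ideal N ring_of_type_algebra" and NA: "N \<subseteq> A"
    and gA: "g \<in> A" and cyclic: "\<And>a. a \<in> A \<Longrightarrow> \<exists>r. a - r * g \<in> N"
    and ug: "u * g \<in> N" and vg: "v ^ m * g \<in> N" and m: "m > 0" and vg': "v ^ (m - 1) * g \<notin> N"
    and local: "\<And>r. \<exists>c w w'. r = c + v * w + u * w' \<and> (c = 0 \<or> c dvd 1)"
  shows "module_length ring_of_type_algebra (quotient_module (ideal_as_module ring_of_type_algebra A) N) = enat m"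
proof -
  let ?R = "ring_of_type_algebra :: 'a ring"
  let ?I = "\<lambda>B. ideal B ?R \<and> N \<subseteq> B \<and> B \<subseteq> A"
  have add: "a + b \<in> B" if "ideal B ?R" "a \<in> B" "b \<in> B" for B a b
    using that by (simp add: ideal_ring_of_type_algebra_iff)
  have mul: "r * a \<in> B" if "ideal B ?R" "a \<in> B" for B a r
    using that by (simp add: ideal_ring_of_type_algebra_iff)
  have diff: "a - b \<in> B" if "ideal B ?R" "a \<in> B" "b \<in> B" for B a b
    using add[OF that(1,2) mul[OF that(1,3), of "- 1"]] by simp
  \<comment> \<open>Expansion in powers of \<open>v\<close> modulo \<open>u\<close>, stopped at the
    first unit coefficient or at exponent \<open>k\<close>.\<close>
  have expand: "(\<exists>w w'. r = v ^ k * w + u * w') \<or>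
      (\<exists>t<k. \<exists>c w w'. c dvd 1 \<and> r = v ^ t * (c + v * w) + u * w')" for k r
  proof (induction k)
    case 0
    show ?case by (intro disjI1 exI[of _ r] exI[of _ 0]) simp
  next
    case (Suc k)
    then show ?case
    proof
      assume "\<exists>w w'. r = v ^ k * w + u * w'"
      then obtain w w' where r: "r = v ^ k * w + u * w'" by blast
      obtain c z z' where w: "w = c + v * z + u * z'" "c = 0 \<or> c dvd 1"
        using local by blast
      have eq: "r = v ^ k * (c + v * z) + u * (w' + v ^ k * z')"
        unfolding r w(1) by (simp add: algebra_simps)
      from w(2) show ?thesis
      proof
        assume "c = 0"
        with eq have "r = v ^ Suc k * z + u * (w' + v ^ k * z')" by (simp add: mult_ac)
        then show ?thesis by blast
      next
        assume "c dvd 1"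
        with eq show ?thesis by blast
      qed
    next
      assume "\<exists>t<k. \<exists>c w w'. c dvd 1 \<and> r = v ^ t * (c + v * w) + u * w'"
      then show ?thesis using less_SucI by blast
    qed
  qed
  txt \<open>A submodule of the cyclic module is determined by the least power of \<open>v\<close> that it contains.\<close>
  define idx where "idx B = (LEAST k. v ^ k * g \<in> B)" for B
  have idx: "v ^ idx B * g \<in> B" "idx B \<le> m" if "?I B" for B
    unfolding idx_def using that vg by (auto intro: LeastI Least_le)
  \<comment> \<open>The index cannot grow under inclusion, so it is enough to refute equality: equal
    indices would force \<open>B'\<close> into \<open>B\<close>.\<close>
  have idx_less: "idx B' < idx B" if B: "?I B" and B': "?I B'" and sub: "B \<subset> B'" for B B'
  proof (rule ccontr)
    assume "\<not> idx B' < idx B"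
    moreover have "idx B' \<le> idx B"
      unfolding idx_def[of B'] using idx(1)[OF B] sub by (intro Least_le) blast
    ultimately have eq: "idx B' = idx B" by simp
    define k where "k = idx B"
    have "a \<in> B" if a: "a \<in> B'" for a
    proof -
      obtain r where r: "a - r * g \<in> N" using cyclic a B' by blast
      have rB': "r * g \<in> B'"
        using diff[of B' a "a - r * g"] a r B' by auto
      show ?thesis
        using expand[of r k]
      proof
        assume "\<exists>w w'. r = v ^ k * w + u * w'"
        then obtain w w' where "r = v ^ k * w + u * w'" by blast
        then have "r * g = w * (v ^ k * g) + w' * (u * g)" by (simp add: algebra_simps)
        moreover have "v ^ k * g \<in> B" using idx(1)[OF B] by (simp add: k_def)
        ultimately have "r * g \<in> B" using add mul B ug by auto
        then show "a \<in> B" using add[of B "a - r * g" "r * g"] B r by auto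
      next
        assume "\<exists>t<k. \<exists>c w w'. c dvd 1 \<and> r = v ^ t * (c + v * w) + u * w'"
        then obtain t c w w' d where t: "t < k" "r = v ^ t * (c + v * w) + u * w'" "1 = c * d"
          by (auto simp: dvd_def)
        \<comment> \<open>Multiplication by \<open>v ^ e\<close> moves the unit coefficient of
          \<open>r\<close> to exponent \<open>k - 1\<close>. Then \<open>v ^ (k - 1) * g\<close>
          lies in \<open>B'\<close>, against the minimality of its index \<open>k\<close>.\<close>
        define e where "e = k - 1 - t"
        have k: "k = Suc (e + t)" using t(1) by (simp add: e_def)
        have "v ^ e * (r * g) - (v ^ e * w') * (u * g) - w * (v ^ k * g) = c * (v ^ (e + t) * g)"
          unfolding t(2) k by (simp add: algebra_simps power_add)
        moreover have "v ^ e * (r * g) - (v ^ e * w') * (u * g) - w * (v ^ k * g) \<in> B'"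
        proof -
          have ids: "ideal B' ?R" "u * g \<in> B'" "v ^ k * g \<in> B'"
            using B' ug idx(1)[OF B'] eq by (auto simp: k_def)
          show ?thesis
            by (rule diff[OF ids(1) diff[OF ids(1)]]; rule mul[OF ids(1)]; fact)
        qed
        ultimately have "d * (c * (v ^ (e + t) * g)) \<in> B'" using mul B' by metis
        moreover have "d * (c * (v ^ (e + t) * g)) = v ^ (e + t) * g"
          by (metis mult.assoc mult.commute mult_1 t(3))
        ultimately have "idx B' \<le> e + t"
          unfolding idx_def by (auto intro: Least_le)
        then show "a \<in> B" using eq k by (simp add: k_def)
      qed
    qed
    then show False using sub by blast
  qed
  define P where "P n \<longleftrightarrow> (\<exists>B. (\<forall>i\<le>n. ?I (B i)) \<and> (\<forall>i<n. B i \<subset> B (Suc i)))" for n :: nat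
  have upper: "n \<le> m" if Pn: "P n" for n
  proof -
    obtain B where B': "\<forall>i\<le>n. ?I (B i)" "\<forall>i<n. B i \<subset> B (Suc i)"
      using Pn unfolding P_def by blast
    have B: "?I (B i)" if "i \<le> n" for i using B'(1) that by blast
    have Bs: "B i \<subset> B (Suc i)" if "i < n" for i using B'(2) that by blast
    have "i \<le> n \<Longrightarrow> idx (B i) + i \<le> m" for i
    proof (induction i)
      case 0
      then show ?case using idx(2)[OF B] by simp
    next
      case (Suc i)
      then show ?case using idx_less[OF B B Bs, of i] by simp
    qed
    from this[of n] show ?thesis by simp
  qed
  have "P m"
  proof -
    \<comment> \<open>A chain attaining the length: \<open>N\<close> plus the multiples of
      \<open>v ^ (m - i) * g\<close>, rising from \<open>N\<close> to \<open>A\<close>.\<close>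
    define B where "B i = {a. \<exists>r. a - r * (v ^ (m - i) * g) \<in> N}" for i
    have "?I (B i)" for i
    proof (intro conjI)
      show "ideal (B i) ?R"
        unfolding ideal_ring_of_type_algebra_iff B_def
      proof safe
        show "\<exists>r. 0 - r * (v ^ (m - i) * g) \<in> N"
          using N by (intro exI[of _ 0]) (simp add: ideal_ring_of_type_algebra_iff)
        fix a b r s assume "a - r * (v ^ (m - i) * g) \<in> N" "b - s * (v ^ (m - i) * g) \<in> N"
        from add[OF N this] show "\<exists>r. a + b - r * (v ^ (m - i) * g) \<in> N"
          by (intro exI[of _ "r + s"]) (simp add: algebra_simps)
      next
        fix a r s assume "a - s * (v ^ (m - i) * g) \<in> N"
        from mul[OF N this, of r] show "\<exists>t. r * a - t * (v ^ (m - i) * g) \<in> N"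
          by (intro exI[of _ "r * s"]) (simp add: algebra_simps)
      qed
      show "N \<subseteq> B i" unfolding B_def by (auto intro: exI[of _ 0])
      show "B i \<subseteq> A"
      proof
        fix a assume "a \<in> B i"
        then obtain r where "a - r * (v ^ (m - i) * g) \<in> A" using NA by (auto simp: B_def)
        from add[OF A this mul[OF A mul[OF A gA], of r "v ^ (m - i)"]] show "a \<in> A" by simp
      qed
    qed
    moreover have "B i \<subset> B (Suc i)" if i: "i < m" for i
    proof
      define e where "e = m - Suc i"
      have e: "m - i = Suc e" "m - 1 = i + e" "m = Suc (i + e)" using i by (auto simp: e_def)
      show "B i \<subseteq> B (Suc i)"
      proof
        fix a assume "a \<in> B i"
        then obtain r where "a - r * (v ^ Suc e * g) \<in> N" by (auto simp: B_def e)
        then show "a \<in> B (Suc i)"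
          unfolding B_def e_def[symmetric] by (intro CollectI exI[of _ "r * v"]) (simp add: mult_ac)
      qed
      have "v ^ e * g \<in> B (Suc i)"
        using N unfolding B_def e_def[symmetric]
        by (intro CollectI exI[of _ 1]) (simp add: ideal_ring_of_type_algebra_iff)
      \<comment> \<open>Otherwise multiplication by \<open>v ^ i\<close> would put
        \<open>v ^ (m - 1) * g\<close> into \<open>N\<close>, since \<open>v ^ m * g\<close> is
        already there.\<close>
      moreover have "v ^ e * g \<notin> B i"
      proof
        assume "v ^ e * g \<in> B i"
        then obtain r where "v ^ e * g - r * (v ^ Suc e * g) \<in> N" by (auto simp: B_def e)
        from add[OF N mul[OF N this, of "v ^ i"] mul[OF N vg, of r]]
        have "v ^ (m - 1) * g \<in> N"
          unfolding e(2) by (simp add: e(3) algebra_simps power_add)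
        then show False using vg' by contradiction
      qed
      ultimately show "B i \<noteq> B (Suc i)" by blast
    qed
    ultimately show ?thesis unfolding P_def by blast
  qed
  have "Sup {enat n |n. P n} = enat m"
    using upper \<open>P m\<close> by (intro antisym Sup_least Sup_upper) auto
  then show ?thesis
    unfolding module_length_quotient[OF A N NA] P_def .
qed

section \<open>Order and linear forms in \<open>k[x,y]\<close>\<close>

text \<open>Membership in the \<open>d\<close>-th power of \<open>(x, y)\<close>. Forms alone do not
  suffice, since the elements of the powers of \<open>I\<close> are in general
  inhomogeneous.\<close>

definition order_ge :: "nat \<Rightarrow> 'k::field poly poly \<Rightarrow> bool" where
  "order_ge d p \<longleftrightarrow> (\<forall>i j. i + j < d \<longrightarrow> poly.coeff (poly.coeff p j) i = 0)"

lemma coeff_coeff_mult: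
  fixes p q :: "'k::field poly poly"
  shows "poly.coeff (poly.coeff (p * q) j) i =
    (\<Sum>b\<le>j. \<Sum>a\<le>i. poly.coeff (poly.coeff p b) a * poly.coeff (poly.coeff q (j - b)) (i - a))"
  by (simp add: coeff_mult coeff_sum)

lemma order_ge_mult:
  assumes "order_ge k p" "order_ge l q"
  shows "order_ge (k + l) (p * q)"
  unfolding order_ge_def coeff_coeff_mult
proof (intro allI impI sum.neutral ballI)
  fix i j a b assume "i + j < k + l" "b \<in> {..j}" "a \<in> {..i}"
  then have "a + b < k \<or> (i - a) + (j - b) < l" by auto
  then show "poly.coeff (poly.coeff p b) a * poly.coeff (poly.coeff q (j - b)) (i - a) = 0"
    using assms by (auto simp: order_ge_def)
qed

lemma order_ge_0 [simp]: "order_ge 0 p"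
  by (simp add: order_ge_def)

lemma order_ge_mono: "order_ge l p \<Longrightarrow> k \<le> l \<Longrightarrow> order_ge k p"
  by (simp add: order_ge_def)

lemma order_ge_mult_left: "order_ge k p \<Longrightarrow> order_ge k (q * p)"
  using order_ge_mult[of 0 q k p] by simp

lemma order_ge_add: "order_ge k p \<Longrightarrow> order_ge k q \<Longrightarrow> order_ge k (p + q)"
  by (simp add: order_ge_def)

lemma order_ge_diff: "order_ge k p \<Longrightarrow> order_ge k q \<Longrightarrow> order_ge k (p - q)"
  by (simp add: order_ge_def)

lemma not_order_ge_1_one: "\<not> order_ge (Suc 0) 1"
  by (auto simp: order_ge_def)

lemma is_form_mult:
  assumes "is_form k p" "is_form l q"
  shows "is_form (k + l) (p * q)"
  unfolding is_form_def
proof (intro allI impI)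
  fix i j assume "poly.coeff (poly.coeff (p * q) j) i \<noteq> 0"
  then obtain b a where "b \<in> {..j}" "a \<in> {..i}"
    "poly.coeff (poly.coeff p b) a * poly.coeff (poly.coeff q (j - b)) (i - a) \<noteq> 0"
    unfolding coeff_coeff_mult by (meson sum.not_neutral_contains_not_neutral)
  moreover from this have "a + b = k" "(i - a) + (j - b) = l"
    using assms by (auto simp: is_form_def)
  ultimately show "i + j = k + l" by auto
qed

lemma is_form_add: "is_form d p \<Longrightarrow> is_form d q \<Longrightarrow> is_form d (p + q)"
  unfolding is_form_def by (metis add.right_neutral coeff_add)

lemma is_form_const: "is_form 0 [:[:c:]:]"
  by (auto simp: is_form_def coeff_pCons split: nat.splits)

lemma is_form_minus: "is_form d p \<Longrightarrow> is_form d (- p)"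
  by (simp add: is_form_def)

lemma is_form_diff: "is_form d p \<Longrightarrow> is_form d q \<Longrightarrow> is_form d (p - q)"
  using is_form_add[of d p "- q"] is_form_minus[of d q] by simp

lemma is_form_const_mult: "is_form d p \<Longrightarrow> is_form d ([:[:c:]:] * p)"
  using is_form_mult[OF is_form_const[of c]] by simp

lemma is_form_imp_order_ge: "is_form d p \<Longrightarrow> order_ge d p"
  unfolding is_form_def order_ge_def by force

lemma is_form_order_ge_imp_zero:
  assumes "is_form d p" "order_ge (Suc d) p"
  shows "p = 0"
proof (intro poly_eqI)
  fix i j show "poly.coeff (poly.coeff p j) i = poly.coeff (poly.coeff 0 j) i"
    using assms by (cases "i + j = d") (auto simp: is_form_def order_ge_def)
qed

text \<open>Split off the constant term, then the remaining monomials free of \<open>y\<close>, then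
  the multiples of \<open>y\<close>. Monomials are merely distributed, so one choice of
  \<open>w1\<close>, \<open>w2\<close> lowers every order and degree bound by one.\<close>

lemma var_decomposition:
  fixes w :: "'k::field poly poly"
  shows "\<exists>c w1 w2. w = [:[:c:]:] + var_x * w1 + var_y * w2 \<and>
    (\<forall>k. order_ge (Suc k) w \<longrightarrow> c = 0 \<and> order_ge k w1 \<and> order_ge k w2) \<and>
    (\<forall>d. is_form (Suc d) w \<longrightarrow> c = 0 \<and> is_form d w1 \<and> is_form d w2) \<and>
    (is_form 0 w \<longrightarrow> w1 = 0 \<and> w2 = 0)"
proof -
  obtain w0 w2 where w: "w = pCons w0 w2" by (cases w)
  obtain c w1 where w0: "w0 = pCons c w1" by (cases w0)
  have co: "poly.coeff (poly.coeff w (Suc j)) i = poly.coeff (poly.coeff w2 j) i"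
    "poly.coeff (poly.coeff w 0) (Suc i) = poly.coeff w1 i"
    "poly.coeff (poly.coeff w 0) 0 = c" for i j
    by (simp_all add: w w0)
  have co1: "poly.coeff (poly.coeff [:w1:] j) i = (if j = 0 then poly.coeff w1 i else 0)" for i j
    by (simp add: coeff_pCons split: nat.splits)
  show ?thesis
  proof (rule exI[of _ c], rule exI[of _ "[:w1:]"], rule exI[of _ w2], intro conjI allI impI)
    show "w = [:[:c:]:] + var_x * [:w1:] + var_y * w2"
      by (simp add: w w0 var_x_def var_y_def)
    show "c = 0" "order_ge k [:w1:]" "order_ge k w2" if "order_ge (Suc k) w" for k
      using that by (auto simp: order_ge_def co1 simp flip: co)
    show "c = 0" "is_form d [:w1:]" "is_form d w2" if "is_form (Suc d) w" for d
    proof -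
      have *: "i + j = Suc d" if "poly.coeff (poly.coeff w j) i \<noteq> 0" for i j
        using that \<open>is_form (Suc d) w\<close> by (simp add: is_form_def)
      show "c = 0" using *[of 0 0] by (auto simp flip: co)
      show "is_form d [:w1:]" using *[of 0 "Suc _"] by (auto simp: is_form_def co1 simp flip: co)
      show "is_form d w2" using *[of "Suc _"] by (auto simp: is_form_def simp flip: co)
    qed
    show "[:w1:] = 0" "w2 = 0" if "is_form 0 w"
      using that by (auto simp: is_form_def poly_eq_iff co1 simp flip: co)
  qed
qed

lemma var_decomposition_order_ge:
  assumes "order_ge (Suc k) w"
  shows "\<exists>w1 w2. w = var_x * w1 + var_y * w2 \<and> order_ge k w1 \<and> order_ge k w2"
proof -
  obtain c w1 w2 where w: "w = [:[:c:]:] + var_x * w1 + var_y * w2"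
    "\<forall>k. order_ge (Suc k) w \<longrightarrow> c = 0 \<and> order_ge k w1 \<and> order_ge k w2"
    using var_decomposition[of w] by (elim exE conjE) (rule that)
  then have "c = 0 \<and> order_ge k w1 \<and> order_ge k w2" using assms by blast
  then show ?thesis using w(1) by (intro exI[of _ w1] exI[of _ w2]) simp
qed

lemma var_decomposition_is_form:
  assumes "is_form (Suc d) w"
  shows "\<exists>w1 w2. w = var_x * w1 + var_y * w2 \<and> is_form d w1 \<and> is_form d w2"
proof -
  obtain c w1 w2 where w: "w = [:[:c:]:] + var_x * w1 + var_y * w2"
    "\<forall>d. is_form (Suc d) w \<longrightarrow> c = 0 \<and> is_form d w1 \<and> is_form d w2"
    using var_decomposition[of w] by (elim exE conjE) (rule that)
  then have "c = 0 \<and> is_form d w1 \<and> is_form d w2" using assms by blast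
  then show ?thesis using w(1) by (intro exI[of _ w1] exI[of _ w2]) simp
qed

lemma is_form_0_imp_const: "is_form 0 w \<Longrightarrow> \<exists>c. w = [:[:c:]:]"
  using var_decomposition[of w] by fastforce

lemma is_form_var: "is_form (Suc 0) var_x" "is_form (Suc 0) var_y"
  by (auto simp: is_form_def var_x_def var_y_def coeff_pCons split: nat.splits)

text \<open>By induction on \<open>d\<close>, the leading forms of the cofactors of \<open>x\<close>
  and \<open>y\<close> are recombined. For \<open>d = 0\<close> the leading form is the constant
  term.\<close>

lemma order_ge_leading_form:
  assumes "order_ge d w"
  obtains D E where "w = D + E" "is_form d D" "order_ge (Suc d) E"
proof -
  have "\<exists>D. is_form d D \<and> order_ge (Suc d) (w - D)"
    using assms
  proof (induction d arbitrary: w)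
    case 0
    obtain c w1 w2 where w: "w = [:[:c:]:] + var_x * w1 + var_y * w2"
      using var_decomposition[of w] by (elim exE conjE) (rule that)
    have "order_ge (Suc 0) (w1 * var_x)" "order_ge (Suc 0) (w2 * var_y)"
      by (intro order_ge_mult_left is_form_imp_order_ge is_form_var)+
    then have "order_ge (Suc 0) (w - [:[:c:]:])"
      unfolding w by (simp add: order_ge_add mult.commute)
    then show ?case using is_form_const by blast
  next
    case (Suc d)
    obtain w1 w2 where w: "w = var_x * w1 + var_y * w2" "order_ge d w1" "order_ge d w2"
      using var_decomposition_order_ge[OF Suc.prems] by (elim exE conjE) (rule that)
    obtain D1 D2 where D: "is_form d D1" "order_ge (Suc d) (w1 - D1)"
      "is_form d D2" "order_ge (Suc d) (w2 - D2)"
      using Suc.IH w by blast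
    have "is_form (Suc d) (var_x * D1 + var_y * D2)"
      using is_form_add[OF is_form_mult[OF is_form_var(1) D(1)] is_form_mult[OF is_form_var(2) D(3)]] by simp
    moreover have "order_ge (Suc (Suc d)) (var_x * (w1 - D1) + var_y * (w2 - D2))"
      using order_ge_add[OF order_ge_mult[OF is_form_imp_order_ge[OF is_form_var(1)] D(2)]
          order_ge_mult[OF is_form_imp_order_ge[OF is_form_var(2)] D(4)]] by simp
    ultimately show ?case
      by (intro exI[of _ "var_x * D1 + var_y * D2"]) (simp add: w(1) algebra_simps)
  qed
  then obtain D where "is_form d D" "order_ge (Suc d) (w - D)" by blast
  then show ?thesis using that[of D "w - D"] by simp
qed

text \<open>The order of \<open>w\<close> is raised one step at a time: the part \<open>D\<close> of
  degree \<open>k\<close> contributes \<open>p * D\<close> to the product in degree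
  \<open>n + k\<close>, so it must vanish because the ring is a domain.\<close>

lemma order_ge_form_mult_cancel:
  assumes p: "is_form n p" "p \<noteq> 0" and pw: "order_ge (k + n) (p * w)"
  shows "order_ge k w"
  using pw
proof (induction k)
  case 0
  show ?case by simp
next
  case (Suc k)
  have "order_ge (k + n) (p * w)" by (rule order_ge_mono[OF Suc.prems]) simp
  then have "order_ge k w" by (rule Suc.IH)
  then obtain D E where w: "w = D + E" and D: "is_form k D" and E: "order_ge (Suc k) E"
    by (rule order_ge_leading_form)
  have "order_ge (Suc (n + k)) (p * w - p * E)"
    using Suc.prems order_ge_mult[OF is_form_imp_order_ge[OF p(1)] E]
    by (intro order_ge_diff) (simp_all add: ac_simps)
  then have "p * D = 0"
    using is_form_order_ge_imp_zero[OF is_form_mult[OF p(1) D]] by (simp add: w algebra_simps)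
  then show ?case using p(2) E by (simp add: w)
qed

section \<open>Coprime linear forms and changes of coordinates\<close>

lemma var_y_dvd_mult_var_x:
  assumes "var_y dvd var_x * w"
  shows "var_y dvd w"
proof -
  obtain a where "var_x * w = var_y * a" using assms by (rule dvdE)
  then have "poly.coeff (var_x * w) 0 = poly.coeff (var_y * a) 0" by simp
  then have "poly.coeff w 0 = 0" by (simp add: var_x_def var_y_def coeff_mult)
  moreover obtain w0 w1 where "w = pCons w0 w1" by (cases w)
  ultimately have "w = var_y * w1" by (simp add: var_y_def)
  then show ?thesis by simp
qed

text \<open>From \<open>a * w = b * s\<close> one gets \<open>s = a * t\<close>, and cancelling
  \<open>a\<close> leaves \<open>w = b * t\<close>. This allows the two elements of a regular pair
  to be swapped.\<close>

lemma dvd_mult_symmetric: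
  fixes a b :: "'a::idom"
  assumes "a \<noteq> 0" "\<And>w. a dvd b * w \<Longrightarrow> a dvd w" "b dvd a * w"
  shows "b dvd w"
proof -
  obtain s where s: "a * w = b * s" using assms(3) by (rule dvdE)
  then have "a dvd s" using assms(2)[of s] by (metis dvd_triv_left)
  then obtain t where "s = a * t" by (rule dvdE)
  with s assms(1) have "w = b * t" by (simp add: mult.left_commute)
  then show ?thesis by simp
qed

text \<open>A replacement for the coordinates \<open>x\<close>, \<open>y\<close>. Linear
  independence is recorded in the form in which it is used: \<open>v\<close> is a nonzerodivisor
  modulo \<open>u\<close>.\<close>

locale linear_coordinates =
  fixes u v :: "'k::field poly poly"
  assumes form_u: "is_form (Suc 0) u" and form_v: "is_form (Suc 0) v"
    and span_x: "\<exists>a b. var_x = [:[:a:]:] * u + [:[:b:]:] * v"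
    and span_y: "\<exists>a b. var_y = [:[:a:]:] * u + [:[:b:]:] * v"
    and coprime: "u dvd v * w \<Longrightarrow> u dvd w"
begin

lemma decomposition:
  "\<exists>c w1 w2. w = [:[:c:]:] + u * w1 + v * w2 \<and>
    (\<forall>k. order_ge (Suc k) w \<longrightarrow> c = 0 \<and> order_ge k w1 \<and> order_ge k w2) \<and>
    (\<forall>d. is_form (Suc d) w \<longrightarrow> c = 0 \<and> is_form d w1 \<and> is_form d w2)"
proof -
  obtain c w1 w2 where w: "w = [:[:c:]:] + var_x * w1 + var_y * w2"
    "\<forall>k. order_ge (Suc k) w \<longrightarrow> c = 0 \<and> order_ge k w1 \<and> order_ge k w2"
    "\<forall>d. is_form (Suc d) w \<longrightarrow> c = 0 \<and> is_form d w1 \<and> is_form d w2"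
    using var_decomposition[of w] by (elim exE conjE)
  obtain a b where x: "var_x = [:[:a:]:] * u + [:[:b:]:] * v" using span_x by blast
  obtain a' b' where y: "var_y = [:[:a':]:] * u + [:[:b':]:] * v" using span_y by blast
  show ?thesis
  proof (intro exI conjI)
    show "w = [:[:c:]:] + u * ([:[:a:]:] * w1 + [:[:a':]:] * w2) + v * ([:[:b:]:] * w1 + [:[:b':]:] * w2)"
      unfolding w(1) x y by (simp only: algebra_simps)
  qed (use w(2,3) in \<open>auto intro!: order_ge_add is_form_add order_ge_mult_left is_form_const_mult
         simp del: mult_pCons_left\<close>)
qed

lemma decomposition_order_ge:
  assumes "order_ge (Suc k) w"
  shows "\<exists>w1 w2. w = u * w1 + v * w2 \<and> order_ge k w1 \<and> order_ge k w2"
proof -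
  obtain c w1 w2 where w: "w = [:[:c:]:] + u * w1 + v * w2"
    "\<forall>k. order_ge (Suc k) w \<longrightarrow> c = 0 \<and> order_ge k w1 \<and> order_ge k w2"
    using decomposition[of w] by (elim exE conjE) (rule that)
  then have "c = 0 \<and> order_ge k w1 \<and> order_ge k w2" using assms by blast
  then show ?thesis using w(1) by (intro exI[of _ w1] exI[of _ w2]) simp
qed

lemma decomposition_is_form:
  assumes "is_form (Suc d) w"
  shows "\<exists>w1 w2. w = u * w1 + v * w2 \<and> is_form d w1 \<and> is_form d w2"
proof -
  obtain c w1 w2 where w: "w = [:[:c:]:] + u * w1 + v * w2"
    "\<forall>d. is_form (Suc d) w \<longrightarrow> c = 0 \<and> is_form d w1 \<and> is_form d w2"
    using decomposition[of w] by (elim exE conjE) (rule that)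
  then have "c = 0 \<and> is_form d w1 \<and> is_form d w2" using assms by blast
  then show ?thesis using w(1) by (intro exI[of _ w1] exI[of _ w2]) simp
qed

lemma u_nonunit: "\<not> u dvd 1"
proof
  assume "u dvd 1"
  then obtain w where "1 = w * u" by (metis dvd_def mult.commute)
  then show False
    using not_order_ge_1_one order_ge_mult_left[OF is_form_imp_order_ge[OF form_u]] by metis
qed

lemma coprime_power: "u dvd v ^ k * w \<Longrightarrow> u dvd w"
  by (induction k) (auto simp: mult.assoc dest: coprime)

text \<open>Modulo \<open>u\<close> the polynomial ring is \<open>k[v]\<close>, where a form of
  degree \<open>n\<close> is a scalar times \<open>v ^ n\<close>. The order of \<open>w\<close> is
  recorded because it later decides membership in powers of \<open>I\<close>.\<close>

lemma form_mod_u: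
  assumes "is_form n p"
  shows "\<exists>c w. p = u * w + [:[:c:]:] * v ^ n \<and> order_ge (n - 1) w"
  using assms
proof (induction n arbitrary: p)
  case 0
  then obtain c where "p = [:[:c:]:]" using is_form_0_imp_const by blast
  then show ?case by (intro exI[of _ c] exI[of _ 0]) simp
next
  case (Suc n)
  obtain w1 w2 where p: "p = u * w1 + v * w2" and w: "is_form n w1" "is_form n w2"
    using decomposition_is_form[OF Suc.prems] by (elim exE conjE) (rule that)
  obtain c w' where w2: "w2 = u * w' + [:[:c:]:] * v ^ n" and w': "order_ge (n - 1) w'"
    using Suc.IH[OF w(2)] by blast
  have "order_ge n (w1 + v * w')"
  proof (intro order_ge_add)
    show "order_ge n w1" by (rule is_form_imp_order_ge[OF w(1)])
    show "order_ge n (v * w')"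
      using order_ge_mult[OF is_form_imp_order_ge[OF form_v] w'] by (rule order_ge_mono) simp
  qed
  moreover have "p = u * (w1 + v * w') + [:[:c:]:] * v ^ Suc n"
    unfolding p w2 by (simp only: power_Suc algebra_simps)
  ultimately show ?case by auto
qed

text \<open>The inhomogeneous counterpart of \<open>form_mod_u\<close>: splitting along
  \<open>u\<close> and \<open>v\<close> again and again collects all terms divisible by
  \<open>u\<close>.\<close>

lemma order_ge_mod_u:
  assumes "order_ge l w"
  shows "\<exists>a b. w = u * a + v ^ l * b \<and> order_ge (l - 1) a"
  using assms
proof (induction l arbitrary: w)
  case 0
  then show ?case by (intro exI[of _ 0] exI[of _ w]) simp
next
  case (Suc l)
  obtain w1 w2 where w: "w = u * w1 + v * w2" "order_ge l w1" "order_ge l w2"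
    using decomposition_order_ge[OF Suc.prems] by blast
  obtain a b where ab: "w2 = u * a + v ^ l * b" "order_ge (l - 1) a"
    using Suc.IH[OF w(3)] by blast
  have "order_ge l (w1 + v * a)"
  proof (rule order_ge_add[OF w(2)])
    show "order_ge l (v * a)"
      using order_ge_mult[OF is_form_imp_order_ge[OF form_v] ab(2)] by (rule order_ge_mono) simp
  qed
  moreover have "w = u * (w1 + v * a) + v ^ Suc l * b"
    unfolding w(1) ab(1) by (simp add: algebra_simps)
  ultimately show ?case by auto
qed

text \<open>Cancelling \<open>v ^ (n - 1)\<close> modulo \<open>u\<close> would put
  \<open>1 - v * b\<close> into \<open>(u)\<close>, hence 1 into \<open>(u, v)\<close>, whose
  elements have order at least 1.\<close>

lemma v_power_notin:
  assumes "n > 0"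
  shows "v ^ (n - 1) \<noteq> u * a + v ^ n * b"
proof
  assume "v ^ (n - 1) = u * a + v ^ n * b"
  then have "v ^ (n - 1) * (1 - v * b) = u * a"
    using assms by (cases n) (auto simp: algebra_simps)
  then have "u dvd 1 - v * b" using coprime_power by (metis dvd_triv_left)
  then obtain t where "1 - v * b = u * t" by (rule dvdE)
  then have "1 = t * u + b * v" by (simp add: algebra_simps)
  moreover have "order_ge (Suc 0) (t * u + b * v)"
    by (intro order_ge_add order_ge_mult_left is_form_imp_order_ge form_u form_v)
  ultimately show False using not_order_ge_1_one by metis
qed

end

text \<open>For \<open>u = a x + b y\<close>, the form \<open>y\<close> completes \<open>u\<close>
  to a basis if \<open>b = 0\<close>, and \<open>x\<close> does so otherwise.\<close>

lemma linear_coordinates_exist: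
  assumes "is_form (Suc 0) u" "u \<noteq> 0"
  shows "\<exists>v. linear_coordinates u v"
proof -
  obtain w1 w2 where u: "u = var_x * w1 + var_y * w2" and w: "is_form 0 w1" "is_form 0 w2"
    using var_decomposition_is_form[OF assms(1)] by (elim exE conjE) (rule that)
  obtain a b where ab: "w1 = [:[:a:]:]" "w2 = [:[:b:]:]"
    using is_form_0_imp_const w by metis
  have x_dvd: "var_x dvd var_y * w \<Longrightarrow> var_x dvd w" for w :: "'a poly poly"
    by (rule dvd_mult_symmetric[of var_y]) (auto simp: var_y_def[symmetric] dest: var_y_dvd_mult_var_x, simp add: var_y_def)
  show ?thesis
  proof (cases "b = 0")
    case True
    then have a: "a \<noteq> 0" using assms u ab by auto
    have u: "u = [:[:a:]:] * var_x" using True unfolding u ab by simp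
    have unit: "[:[:inverse a:]:] * [:[:a:]:] = 1" using a by (simp add: one_pCons)
    have "linear_coordinates u var_y"
    proof
      have "var_x = [:[:inverse a:]:] * u + [:[:0:]:] * var_y"
        unfolding u mult.assoc[symmetric] unit by simp
      then show "\<exists>a b. var_x = [:[:a:]:] * u + [:[:b:]:] * var_y" by blast
      have "var_y = [:[:0:]:] * u + [:[:1:]:] * var_y" by (simp add: pCons_one)
      then show "\<exists>a b. var_y = [:[:a:]:] * u + [:[:b:]:] * var_y" by blast
      show "u dvd w" if "u dvd var_y * w" for w
      proof -
        have "var_x dvd var_y * w" using that unfolding u by (rule dvd_mult_right)
        then obtain s where "w = var_x * s" using x_dvd by blast
        moreover have "u * ([:[:inverse a:]:] * s) = [:[:inverse a:]:] * [:[:a:]:] * (var_x * s)"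
          unfolding u by (simp only: ac_simps)
        ultimately have "w = u * ([:[:inverse a:]:] * s)" by (simp only: unit mult_1)
        then show ?thesis by (rule dvdI)
      qed
    qed (use assms is_form_var in auto)
    then show ?thesis by blast
  next
    case False
    have u: "u = [:[:a:]:] * var_x + [:[:b:]:] * var_y" unfolding u ab by (simp only: mult.commute)
    have unit: "[:[:inverse b:]:] * [:[:b:]:] = 1" using False by (simp add: one_pCons)
    have y: "var_y = [:[:inverse b:]:] * u + [:[:- a * inverse b:]:] * var_x"
    proof -
      have "[:[:- a * inverse b:]:] = - ([:[:inverse b:]:] * [:[:a:]:])" by simp
      moreover have "y = i * (A * x + B * y) + - (i * A) * x" if "i * B = 1" for i A B x y :: "'a poly poly"
      proof -
        have "i * (A * x + B * y) + - (i * A) * x = i * B * y" by (simp add: algebra_simps)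
        then show ?thesis using that by simp
      qed
      ultimately show ?thesis unfolding u using unit by metis
    qed
    have "linear_coordinates u var_x"
    proof
      have "var_x = [:[:0:]:] * u + [:[:1:]:] * var_x" by (simp add: pCons_one)
      then show "\<exists>a b. var_x = [:[:a:]:] * u + [:[:b:]:] * var_x" by blast
      show "\<exists>a b. var_y = [:[:a:]:] * u + [:[:b:]:] * var_x" using y by blast
      show "u dvd w" if "u dvd var_x * w" for w
      \<comment> \<open>By symmetry it suffices that \<open>u\<close> is a nonzerodivisor modulo
        \<open>var_x\<close>, where it is a nonzero scalar multiple of \<open>var_y\<close>.\<close>
      proof (rule dvd_mult_symmetric[of var_x])
        show "var_x \<noteq> (0 :: 'a poly poly)" by (simp add: var_x_def)
        show "u dvd var_x * w" by fact
        fix s assume "var_x dvd u * s"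
        then obtain t where t: "u * s = var_x * t" by (rule dvdE)
        have "y * s = x * (i * t + c * s)" if "y = i * u + c * x" "u * s = x * t"
          for x y i c :: "'a poly poly"
        proof -
          have "y * s = i * (u * s) + x * (c * s)" unfolding that(1) by (simp add: algebra_simps)
          then show ?thesis unfolding that(2) by (simp add: algebra_simps)
        qed
        from this[OF y t]
        have "var_y * s = var_x * ([:[:inverse b:]:] * t + [:[:- a * inverse b:]:] * s)" .
        then have "var_x dvd var_y * s" by simp
        then show "var_x dvd s" by (rule x_dvd)
      qed
    qed (use assms is_form_var in auto)
    then show ?thesis by blast
  qed
qed

section \<open>The ideal \<open>(p, uq, vq)\<close>\<close>

text \<open>The normal form that the matrix is reduced to. Together with \<open>p0\<close>, the
  assumption \<open>regular\<close> encodes the regularity of the pair \<open>p\<close>,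
  \<open>u * q\<close> as divisibility.\<close>

locale linear_column = linear_coordinates u v for u v :: "'k::field poly poly" +
  fixes p q :: "'k poly poly" and n :: nat
  assumes n: "n > 0" and form_p: "is_form n p" and form_q: "is_form (n - 1) q" and p0: "p \<noteq> 0"
    and regular: "p dvd u * q * w \<Longrightarrow> p dvd w"
begin

abbreviation "I \<equiv> Idl\<^bsub>Rxy\<^esub> {p, u * q, v * q}"
abbreviation "J \<equiv> Idl\<^bsub>Rxy\<^esub> {p, u * q}"
abbreviation "P k \<equiv> ideal_power Rxy I k"

lemma dvd_q_power: "p dvd q ^ k * w \<Longrightarrow> p dvd w"
proof (induction k)
  case (Suc k)
  then have "p dvd u * q * (q ^ k * w)" by (simp add: mult.assoc dvd_mult)
  then show ?case using Suc.IH regular by blast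
qed simp

lemma dvd_u: "p dvd u * w \<Longrightarrow> p dvd w"
  using regular[of w] by (metis dvd_mult mult.assoc mult.commute)

lemma ideal_I: "ideal I Rxy" and ideal_J: "ideal J Rxy" and ideal_P: "ideal (P k) Rxy"
  and ideal_JP: "ideal (J \<cdot>\<^bsub>Rxy\<^esub> P k) Rxy"
  by (simp_all add: ideal_genideal ideal_ideal_power ideal_ideal_prod)

lemma mem_J_iff: "z \<in> J \<longleftrightarrow> (\<exists>a b. z = p * a + u * q * b)"
  unfolding mem_genideal_insert[of z p] Bex_def mem_genideal_singleton by blast

lemma mem_I_iff: "z \<in> I \<longleftrightarrow> (\<exists>a b c. z = p * a + (u * q * b + v * q * c))"
  unfolding mem_genideal_insert[of z p] mem_genideal_insert[of _ "u * q"] Bex_def mem_genideal_singleton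
  by blast

lemma p_in_J: "p \<in> J" and uq_in_J: "u * q \<in> J"
  using genideal_superset[of "{p, u * q}"] by auto

lemma vq_in_I: "v * q \<in> I"
  using genideal_superset[of "{p, u * q, v * q}"] by auto

lemma J_subset_I: "J \<subseteq> I"
  using genideal_superset[of "{p, u * q, v * q}"] by (intro genideal_least ideal_genideal) auto

lemma q_mult_in_I:
  assumes "order_ge (Suc 0) w"
  shows "q * w \<in> I"
proof -
  obtain w1 w2 where "w = u * w1 + v * w2"
    using decomposition_order_ge[OF assms] by blast
  then show ?thesis
    unfolding mem_I_iff by (intro exI[of _ 0] exI[of _ w1] exI[of _ w2]) (simp add: algebra_simps)
qed

section \<open>Powers of \<open>I\<close> and the colon by \<open>p\<close>\<close>

text \<open>Each splitting of \<open>w\<close> along \<open>u\<close> and \<open>v\<close> uses up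
  one factor \<open>q\<close>, as \<open>u * q\<close> and \<open>v * q\<close> lie in
  \<open>I\<close>.\<close>

lemma q_power_mult_in_P: "order_ge k w \<Longrightarrow> q ^ k * w \<in> P k"
proof (induction k arbitrary: w)
  case (Suc k)
  obtain w1 w2 where w: "w = u * w1 + v * w2" "order_ge k w1" "order_ge k w2"
    using decomposition_order_ge[OF Suc.prems] by blast
  have "q ^ k * w1 * (u * q) + q ^ k * w2 * (v * q) \<in> P (Suc k)"
    unfolding ideal_power_simps using w Suc.IH vq_in_I uq_in_J J_subset_I
    by (intro ideal_add[OF ideal_ideal_prod] ideal_prodI ideal_P ideal_I) auto
  then show ?case unfolding w(1) by (simp add: algebra_simps)
qed simp

text \<open>An inductive step whose assumption about \<open>s\<close> is weaker than its conclusion.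
  At level \<open>k\<close> only the products \<open>q * h * s\<close> are controlled, a condition
  that also makes sense for \<open>k = 0\<close>, where there is no previous power.\<close>

lemma P_Suc_expand_aux:
  assumes P: "\<And>i. i \<in> P k \<Longrightarrow> \<exists>s w. i = p * s + q ^ k * w \<and> order_ge k w \<and>
      (\<forall>h. order_ge (Suc 0) h \<longrightarrow> q * h * s \<in> P k)"
    and z: "z \<in> P (Suc k)"
  shows "\<exists>s w. z = p * s + q ^ Suc k * w \<and> s \<in> P k \<and> order_ge (Suc k) w"
  using z unfolding ideal_power_simps
proof induction
  case (prod i j)
  obtain s w where i: "i = p * s + q ^ k * w" "order_ge k w"
    and s: "\<And>h. order_ge (Suc 0) h \<Longrightarrow> q * h * s \<in> P k"
    using P[OF prod(1)] by blast
  obtain a b c where j: "j = p * a + (u * q * b + v * q * c)"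
    using prod(2) unfolding mem_I_iff by blast
  define h where "h = u * b + v * c"
  have h: "order_ge (Suc 0) h"
    unfolding h_def using form_u form_v
    by (metis is_form_imp_order_ge mult.commute order_ge_add order_ge_mult_left)
  \<comment> \<open>The factor \<open>p * a\<close> is kept multiplied with all of \<open>i\<close>
    rather than with its expansion, so that the cofactor of \<open>p\<close> lies in
    \<open>P k\<close>.\<close>
  have "i * j = p * (a * i + q * h * s) + q ^ Suc k * (w * h)"
    unfolding i j h_def by (simp add: algebra_simps)
  moreover have "a * i + q * h * s \<in> P k"
    by (intro ideal_add[OF ideal_P] ideal_mult[OF ideal_P] prod(1) s h)
  moreover have "order_ge (Suc k) (w * h)"
    using order_ge_mult[OF i(2) h] by simp
  ultimately show ?case by auto
next
  case (sum z1 z2)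
  then obtain s1 w1 s2 w2 where
    z: "z1 = p * s1 + q ^ Suc k * w1" "z2 = p * s2 + q ^ Suc k * w2"
    and s: "s1 \<in> P k" "s2 \<in> P k" and w: "order_ge (Suc k) w1" "order_ge (Suc k) w2" by blast
  from z have "z1 + z2 = p * (s1 + s2) + q ^ Suc k * (w1 + w2)"
    by (simp add: algebra_simps)
  with ideal_add[OF ideal_P s] order_ge_add[OF w] show ?case
    unfolding ring_of_type_algebra_simps by blast
qed

lemma P_expand:
  assumes "z \<in> P k"
  shows "\<exists>s w. z = p * s + q ^ k * w \<and> order_ge k w \<and> (\<forall>h. order_ge (Suc 0) h \<longrightarrow> q * h * s \<in> P k)"
  using assms
proof (induction k arbitrary: z)
  case 0
  then show ?case by (intro exI[of _ 0] exI[of _ z]) simp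
next
  case (Suc k)
  obtain s w where z: "z = p * s + q ^ Suc k * w" "s \<in> P k" "order_ge (Suc k) w"
    using P_Suc_expand_aux[OF Suc.IH Suc.prems] by blast
  have "q * h * s \<in> P (Suc k)" if "order_ge (Suc 0) h" for h
    using ideal_prodI[OF z(2) q_mult_in_I[OF that]] by (simp add: mult.commute)
  then show ?case using z by blast
qed

lemma P_Suc_expand:
  "z \<in> P (Suc k) \<Longrightarrow> \<exists>s w. z = p * s + q ^ Suc k * w \<and> s \<in> P k \<and> order_ge (Suc k) w"
  by (rule P_Suc_expand_aux[OF P_expand])

text \<open>Since \<open>p\<close> is coprime to \<open>q\<close>, it divides \<open>w\<close>, and
  \<open>s - s'\<close> becomes \<open>q ^ k * (q * w')\<close>. Cancelling \<open>p\<close> loses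
  order \<open>n\<close> and \<open>q\<close> gives back \<open>n - 1\<close>, so order
  \<open>k + 1\<close> turns into order \<open>k\<close>.\<close>

lemma P_Suc_colon_p:
  assumes "p * s \<in> P (Suc k)"
  shows "s \<in> P k"
proof -
  obtain s' w where s': "p * s = p * s' + q ^ Suc k * w" "s' \<in> P k" and w: "order_ge (Suc k) w"
    using P_Suc_expand[OF assms] by blast
  have "q ^ Suc k * w = p * (s - s')" using s'(1) by (simp add: algebra_simps)
  then have "p dvd w" using dvd_q_power by (metis dvd_triv_left)
  then obtain w' where w': "w = p * w'" by (rule dvdE)
  \<comment> \<open>If \<open>Suc k < n\<close>, the truncated difference is 0 and the bound on
    \<open>w'\<close> is empty.\<close>
  have "order_ge (Suc k - n + n) (p * w') \<or> Suc k - n = 0"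
    using w by (cases "n \<le> Suc k") (auto simp: w')
  then have ord: "order_ge (Suc k - n) w'"
    using order_ge_form_mult_cancel[OF form_p p0] by auto
  have "p * s = p * (s' + q ^ Suc k * w')"
    using s'(1) unfolding w' by (simp add: algebra_simps)
  then have s: "s = s' + q ^ k * (q * w')" using p0 by (simp add: mult_ac)
  have "order_ge k (q * w')"
    using order_ge_mult[OF is_form_imp_order_ge[OF form_q] ord] by (rule order_ge_mono) (use n in linarith)
  then show ?thesis
    unfolding s by (intro ideal_add[OF ideal_P] s'(2) q_power_mult_in_P)
qed

section \<open>The length of \<open>F_j\<close>\<close>

text \<open>This coarser containment is enough to exclude an element from the product, since it
  forgets only conditions on the cofactors.\<close>

lemma JP_expand:
  assumes "z \<in> J \<cdot>\<^bsub>Rxy\<^esub> P k"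
  shows "\<exists>s b. z = p * s + u * q ^ Suc k * b"
  using assms
proof induction
  case (prod h i)
  obtain a b where h: "h = p * a + u * q * b" using prod(1) by (auto simp: mem_J_iff)
  obtain s w where i: "i = p * s + q ^ k * w" using P_expand[OF prod(2)] by blast
  have "h * i = p * (a * i + u * q * b * s) + u * q ^ Suc k * (b * w)"
    unfolding h i by (simp add: algebra_simps)
  then show ?case by auto
next
  case (sum z1 z2)
  then obtain s1 b1 s2 b2 where "z1 = p * s1 + u * q ^ Suc k * b1" "z2 = p * s2 + u * q ^ Suc k * b2"
    by blast
  then have "z1 + z2 = p * (s1 + s2) + u * q ^ Suc k * (b1 + b2)" by (simp add: algebra_simps)
  then show ?case by auto
qed

text \<open>If \<open>c\<close> were 0, then \<open>p = u * w\<close>. As \<open>u\<close> is a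
  nonzerodivisor modulo \<open>p\<close>, this would make \<open>p\<close> divide \<open>w\<close>
  and hence \<open>u\<close> a unit.\<close>

lemma p_form_mod_u: "\<exists>c w. p = u * w + [:[:c:]:] * v ^ n \<and> c \<noteq> 0 \<and> order_ge (n - 1) w"
proof -
  obtain c w where p: "p = u * w + [:[:c:]:] * v ^ n" "order_ge (n - 1) w"
    using form_mod_u[OF form_p] by blast
  have "c \<noteq> 0"
  proof
    assume "c = 0"
    then have "p = u * w" using p(1) by simp
    then have "p dvd w" using dvd_u by (metis dvd_refl)
    then obtain t where "w = p * t" by (rule dvdE)
    with \<open>p = u * w\<close> have "p * (u * t) = p * 1" by (simp add: mult_ac)
    then have "u * t = 1" using p0 by (metis mult_left_cancel)
    then show False using u_nonunit by (metis dvd_triv_left)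
  qed
  then show ?thesis using p by blast
qed

text \<open>The case \<open>j = Suc k\<close>, by the criterion for cyclic quotients with
  \<open>m = n - j\<close> and the class of \<open>(v * q) ^ j\<close> as generator.\<close>

lemma module_length_fiber:
  assumes k: "Suc k < n"
  shows "module_length Rxy (quotient_module (ideal_as_module Rxy (P (Suc k))) (J \<cdot>\<^bsub>Rxy\<^esub> P k)) = enat (n - Suc k)"
proof (rule module_length_cyclic_quotient[where u = u and v = v and g = "(v * q) ^ Suc k"])
  note JP_add = ideal_add[OF ideal_JP[of k]] and JP_mult = ideal_mult[OF ideal_JP[of k]]
  obtain c w where p: "p = u * w + [:[:c:]:] * v ^ n" "c \<noteq> 0" "order_ge (n - 1) w"
    using p_form_mod_u by blast
  show "ideal (P (Suc k)) Rxy" "ideal (J \<cdot>\<^bsub>Rxy\<^esub> P k) Rxy"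
    by (rule ideal_P ideal_JP)+
  show "J \<cdot>\<^bsub>Rxy\<^esub> P k \<subseteq> P (Suc k)"
  proof (rule ideal_prod_least[OF ideal_P])
    show "a * b \<in> P (Suc k)" if "a \<in> J" "b \<in> P k" for a b
      using ideal_prodI[of b "P k" a I] that J_subset_I by (auto simp: mult.commute)
  qed
  have vk: "order_ge l (v ^ l)" for l
    by (induction l) (use order_ge_mult[OF is_form_imp_order_ge[OF form_v]] in auto)
  show "(v * q) ^ Suc k \<in> P (Suc k)"
    using q_power_mult_in_P[OF vk[of "Suc k"]] unfolding power_mult_distrib by (simp only: mult.commute)
  have uq: "u * q ^ Suc k * b \<in> J \<cdot>\<^bsub>Rxy\<^esub> P k" if "order_ge k b" for b
    using ideal_prodI[OF uq_in_J q_power_mult_in_P[OF that]] by (simp add: mult_ac)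
  have pP: "p * s \<in> J \<cdot>\<^bsub>Rxy\<^esub> P k" if "s \<in> P k" for s
    using ideal_prodI[OF p_in_J that] .
  \<comment> \<open>Reducing \<open>w\<close> modulo \<open>u\<close> isolates a multiple of the
    generator. What remains is \<open>p\<close> times an element of \<open>P k\<close> plus
    \<open>u * q\<close> times one of the form \<open>q ^ k * b\<close> with \<open>b\<close> of
    order at least \<open>k\<close>.\<close>
  show "\<exists>r. a - r * (v * q) ^ Suc k \<in> J \<cdot>\<^bsub>Rxy\<^esub> P k" if aP: "a \<in> P (Suc k)" for a
  proof -
    obtain s w where a: "a = p * s + q ^ Suc k * w" "s \<in> P k" and w: "order_ge (Suc k) w"
      using P_Suc_expand[OF aP] by blast
    from order_ge_mod_u[OF w] obtain b c where w: "w = u * b + v ^ Suc k * c" "order_ge k b" by auto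
    have "a - c * (v * q) ^ Suc k = p * s + u * q ^ Suc k * b"
      unfolding a w(1) power_mult_distrib by (simp add: algebra_simps)
    also have "\<dots> \<in> J \<cdot>\<^bsub>Rxy\<^esub> P k"
      by (intro JP_add pP uq a w)
    finally show ?thesis by blast
  qed
  show "u * (v * q) ^ Suc k \<in> J \<cdot>\<^bsub>Rxy\<^esub> P k"
  proof -
    have "u * (v * q) ^ Suc k = v * (u * q ^ Suc k * v ^ k)"
      by (simp add: power_mult_distrib mult_ac)
    then show ?thesis using JP_mult[OF uq[OF vk]] by metis
  qed
  show "n - Suc k > 0" using k by simp
  \<comment> \<open>Multiply \<open>c * v ^ n = p - u * w\<close> by \<open>q ^ Suc k\<close>. Both
    terms lie in the product because \<open>q\<close> and \<open>w\<close> have order at least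
    \<open>n - 1\<close>, hence at least \<open>k\<close>.\<close>
  show "v ^ (n - Suc k) * (v * q) ^ Suc k \<in> J \<cdot>\<^bsub>Rxy\<^esub> P k"
  proof -
    have kn: "k \<le> n - 1" using k by simp
    have e: "v ^ (n - Suc k) * (v * q) ^ Suc k = v ^ n * q ^ Suc k"
      using k by (simp add: power_mult_distrib power_add[symmetric] mult.assoc[symmetric] del: power_Suc)
    have "[:[:inverse c:]:] * [:[:c:]:] = 1" using p(2) by (simp add: pCons_one)
    then have "v ^ n * q ^ Suc k = [:[:inverse c:]:] * [:[:c:]:] * (v ^ n * q ^ Suc k)" by (simp only: mult_1)
    also have "\<dots> = [:[:inverse c:]:] * ([:[:c:]:] * v ^ n * q ^ Suc k)" by (simp only: mult.assoc)
    also have "[:[:c:]:] * v ^ n = p - u * w" by (subst p(1)) (simp only: add_diff_cancel_left')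
    also have "(p - u * w) * q ^ Suc k = p * (q ^ k * q) - u * q ^ Suc k * w"
      by (simp add: algebra_simps)
    also have "[:[:inverse c:]:] * \<dots> \<in> J \<cdot>\<^bsub>Rxy\<^esub> P k"
      by (intro JP_mult ideal_diff[OF ideal_JP] pP uq q_power_mult_in_P
          order_ge_mono[OF is_form_imp_order_ge[OF form_q] kn] order_ge_mono[OF p(3) kn])
    finally show ?thesis unfolding e .
  qed
  \<comment> \<open>Cancelling the power of \<open>q\<close> modulo \<open>p\<close> would express
    \<open>v ^ (n - 1)\<close> through \<open>u\<close> and \<open>p\<close>, hence through
    \<open>u\<close> and \<open>v ^ n\<close>.\<close>
  show "v ^ (n - Suc k - 1) * (v * q) ^ Suc k \<notin> J \<cdot>\<^bsub>Rxy\<^esub> P k"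
  proof
    assume *: "v ^ (n - Suc k - 1) * (v * q) ^ Suc k \<in> J \<cdot>\<^bsub>Rxy\<^esub> P k"
    have "n - 1 = (n - Suc k - 1) + Suc k" using k by simp
    then have "v ^ (n - Suc k - 1) * (v * q) ^ Suc k = v ^ (n - 1) * q ^ Suc k"
      by (simp only: power_mult_distrib power_add mult.assoc)
    with * have "v ^ (n - 1) * q ^ Suc k \<in> J \<cdot>\<^bsub>Rxy\<^esub> P k" by (simp only:)
    then obtain s b where "v ^ (n - 1) * q ^ Suc k = p * s + u * q ^ Suc k * b"
      using JP_expand by blast
    then have "q ^ Suc k * (v ^ (n - 1) - u * b) = p * s" by (simp add: algebra_simps)
    then have "p dvd v ^ (n - 1) - u * b" using dvd_q_power by (metis dvd_triv_left)
    then obtain t where "v ^ (n - 1) - u * b = p * t" by (rule dvdE)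
    then have "v ^ (n - 1) = u * b + (u * w + [:[:c:]:] * v ^ n) * t"
      by (subst p(1)[symmetric]) (simp add: algebra_simps)
    also have "\<dots> = u * (b + w * t) + v ^ n * ([:[:c:]:] * t)"
      by (simp only: algebra_simps)
    finally show False using v_power_notin[OF n] by metis
  qed
  show "\<exists>c w w'. r = c + v * w + u * w' \<and> (c = 0 \<or> c dvd 1)" for r
  proof -
    obtain c w1 w2 where r: "r = [:[:c:]:] + u * w1 + v * w2"
      using decomposition[of r] by (elim exE conjE) (rule that)
    then have "r = [:[:c:]:] + v * w2 + u * w1" by (simp only: ac_simps)
    moreover have "[:[:c:]:] = 0 \<or> [:[:c:]:] dvd 1"
    proof (cases "c = 0")
      case False
      then have "1 = [:[:c:]:] * [:[:inverse c:]:]" by (simp add: pCons_one)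
      then show ?thesis by (metis dvd_triv_left)
    qed simp
    ultimately show ?thesis by blast
  qed
qed

end

section \<open>The Rees algebra\<close>

lemma rees_algebra_simps [simp]:
  fixes I :: "'a::comm_ring_1 set"
  shows "carrier (rees_algebra I) = {f. \<forall>i. poly.coeff f i \<in> ideal_power ring_of_type_algebra I i}"
    "mult (rees_algebra I) = (*)" "add (rees_algebra I) = (+)"
    "one (rees_algebra I) = 1" "zero (rees_algebra I) = 0"
  by (simp_all add: rees_algebra_def)

lemma ideal_sum:
  fixes A :: "'a::comm_ring_1 set"
  assumes "ideal A ring_of_type_algebra" "\<And>x. x \<in> T \<Longrightarrow> f x \<in> A"
  shows "sum f T \<in> A"
  using assms(2)
  by (induction T rule: infinite_finite_induct)
    (use assms(1) in \<open>auto simp: ideal_ring_of_type_algebra_iff\<close>)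

text \<open>A subring of the polynomial ring: the \<open>i\<close>-th coefficient of a product is a
  sum of products from the powers \<open>j\<close> and \<open>i - j\<close> of
  \<open>I\<close>.\<close>

lemma cring_rees_algebra:
  fixes I :: "'a::comm_ring_1 set"
  assumes I: "ideal I ring_of_type_algebra"
  shows "cring (rees_algebra I)"
proof -
  let ?R = "ring_of_type_algebra :: 'a poly ring"
  interpret R: cring ?R by (rule cring_from_type_algebra)
  note idl = ideal_ideal_power[OF I]
  let ?S = "{f. \<forall>i. poly.coeff f i \<in> ideal_power ring_of_type_algebra I i}"
  have "subring ?S ?R"
  proof (rule R.subringI)
    show "?S \<subseteq> carrier ?R" by simp
    show "\<one>\<^bsub>?R\<^esub> \<in> ?S"
    proof -
      have "poly.coeff 1 i \<in> ideal_power ring_of_type_algebra I i" for i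
        using idl[of i] by (cases i) (simp_all add: ideal_ring_of_type_algebra_iff)
      then show ?thesis by simp
    qed
    show "\<ominus>\<^bsub>?R\<^esub> h \<in> ?S" if "h \<in> ?S" for h
    proof -
      have "\<ominus>\<^bsub>?R\<^esub> h = - h" by (rule R.minus_equality) simp_all
      moreover have "- poly.coeff h i \<in> ideal_power ring_of_type_algebra I i" for i
        using ideal_mult[OF idl, of "poly.coeff h i" i "- 1"] that by simp
      ultimately show ?thesis by simp
    qed
    show "h1 \<otimes>\<^bsub>?R\<^esub> h2 \<in> ?S" if "h1 \<in> ?S" "h2 \<in> ?S" for h1 h2
    proof -
      have "poly.coeff (h1 * h2) i \<in> ideal_power ring_of_type_algebra I i" for i
        unfolding coeff_mult
      proof (rule ideal_sum[OF idl])
        fix j assume "j \<in> {..i}"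
        then show "poly.coeff h1 j * poly.coeff h2 (i - j) \<in> ideal_power ring_of_type_algebra I i"
          using ideal_power_mult[OF I, of "poly.coeff h1 j" j "poly.coeff h2 (i - j)" "i - j"] that by simp
      qed
      then show ?thesis by simp
    qed
    show "h1 \<oplus>\<^bsub>?R\<^esub> h2 \<in> ?S" if "h1 \<in> ?S" "h2 \<in> ?S" for h1 h2
      using that ideal_add[OF idl] by simp
  qed
  then have "subcring ?S ?R" by (rule R.subcringI')
  then show ?thesis
    using R.subcring_iff[of ?S] by (simp add: rees_algebra_def)
qed

section \<open>A regular sequence of length two in the Rees algebra\<close>

context linear_column
begin

abbreviation "S \<equiv> rees_algebra I"

lemma const_in_S: "[:a:] \<in> carrier S"
proof -
  have "poly.coeff [:a:] i \<in> P i" for i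
    using ideal_P[of i] by (cases i) (simp_all add: ideal_ring_of_type_algebra_iff)
  then show ?thesis by simp
qed

lemma monom_in_S:
  assumes "a \<in> I"
  shows "Polynomial.monom a 1 \<in> carrier S"
proof -
  have "1 * a \<in> P 1"
    using ideal_prodI[of 1 UNIV a I] assms by (auto simp: nat_pow_def)
  then have "poly.coeff (Polynomial.monom a 1) i \<in> P i" for i
    using ideal_P[of i] by (cases "i = 1") (simp_all add: ideal_ring_of_type_algebra_iff)
  then show ?thesis by simp
qed

lemma monom_p_in_S: "Polynomial.monom p 1 \<in> carrier S"
  using monom_in_S p_in_J J_subset_I by blast

text \<open>The elements with constant coefficient divisible by \<open>u\<close> form an ideal that
  omits 1. It contains both generators, as \<open>p t\<close> has constant coefficient 0.\<close>

lemma u_monom_p_proper: "Idl\<^bsub>S\<^esub> {[:u:], Polynomial.monom p 1} \<noteq> carrier S"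
proof -
  interpret S: cring S by (rule cring_rees_algebra[OF ideal_I])
  let ?T = "{f \<in> carrier S. u dvd poly.coeff f 0}"
  have "ideal ?T S"
  proof (rule idealI[OF S.ring_axioms])
    show "subgroup ?T (add_monoid S)"
    proof (rule S.add.subgroupI)
      show "?T \<subseteq> carrier S" by blast
      show "?T \<noteq> {}" using S.zero_closed by (auto intro!: exI[of _ 0])
      show "\<ominus>\<^bsub>S\<^esub> f \<in> ?T" if f: "f \<in> ?T" for f
      proof -
        have "[:- 1:] \<otimes>\<^bsub>S\<^esub> f \<in> carrier S" using f const_in_S by (intro S.m_closed) auto
        then have neg: "- f \<in> carrier S" by simp
        then have "\<ominus>\<^bsub>S\<^esub> f = - f" using f by (intro S.minus_equality) auto
        then show ?thesis using neg f by simp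
      qed
      show "f \<oplus>\<^bsub>S\<^esub> g \<in> ?T" if "f \<in> ?T" "g \<in> ?T" for f g
        using that S.a_closed[of f g] by auto
    qed
    show "g \<otimes>\<^bsub>S\<^esub> f \<in> ?T" "f \<otimes>\<^bsub>S\<^esub> g \<in> ?T" if "f \<in> ?T" "g \<in> carrier S" for f g
      using that S.m_closed[of f g] S.m_closed[of g f] by (auto simp: coeff_mult)
  qed
  moreover have "{[:u:], Polynomial.monom p 1} \<subseteq> ?T"
    using const_in_S[of u] monom_p_in_S by simp
  ultimately have "Idl\<^bsub>S\<^esub> {[:u:], Polynomial.monom p 1} \<subseteq> ?T"
    by (rule S.genideal_minimal)
  moreover have "1 \<in> carrier S" "1 \<notin> ?T" using u_nonunit S.one_closed by auto
  ultimately show ?thesis by blast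
qed

lemma u_neq_0: "u \<noteq> 0"
proof
  assume "u = 0"
  then have "p dvd 1" using regular[of 1] by simp
  moreover have "order_ge (Suc 0) p"
    using order_ge_mono[OF is_form_imp_order_ge[OF form_p], of "Suc 0"] n by simp
  ultimately show False
    using not_order_ge_1_one order_ge_mult_left[of "Suc 0" p] by (metis dvdE mult.commute)
qed

text \<open>For the second element, dividing \<open>f\<close> by \<open>u\<close> in the polynomial
  ring is not enough: the coefficients of the quotient must lie in the right powers of
  \<open>I\<close>. This is what \<open>P_Suc_colon_p\<close> supplies.\<close>

lemma regular_sequence_u_monom_p: "regular_sequence S [[:u:], Polynomial.monom p 1]"
proof -
  interpret S: cring S by (rule cring_rees_algebra[OF ideal_I])
  have Idl0: "Idl\<^bsub>S\<^esub> {} = {0}"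
    using S.genideal_minimal[OF S.zeroideal, of "{}"] S.genideal_ideal[of "{}"]
      additive_subgroup.zero_closed[OF ideal.axioms(1)] by fastforce
  have Idl1: "Idl\<^bsub>S\<^esub> {[:u:]} = {f * [:u:] |f. f \<in> carrier S}"
    using S.cgenideal_eq_genideal[OF const_in_S[of u]] by (simp add: cgenideal_def)
  have "f \<in> Idl\<^bsub>S\<^esub> {[:u:]}" if f: "f \<in> carrier S" "Polynomial.monom p 1 * f \<in> Idl\<^bsub>S\<^esub> {[:u:]}" for f
  proof -
    obtain g where g: "g \<in> carrier S" "Polynomial.monom p 1 * f = g * [:u:]"
      using f(2) unfolding Idl1 by blast
    have co: "p * poly.coeff f i = u * poly.coeff g (Suc i)" for i
      using arg_cong[OF g(2), of "\<lambda>h. poly.coeff h (Suc i)"]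
      by (simp add: coeff_monom_mult)
    have "\<exists>s. poly.coeff f i = u * s \<and> s \<in> P i" for i
    proof -
      have "p dvd poly.coeff g (Suc i)" using co dvd_u by (metis dvd_triv_left)
      then obtain s where s: "poly.coeff g (Suc i) = p * s" by (rule dvdE)
      then have "p * poly.coeff f i = p * (u * s)" using co by (simp add: mult_ac)
      then have "poly.coeff f i = u * s" using p0 by (metis mult_left_cancel)
      moreover have "p * s \<in> P (Suc i)" using g(1) s by (metis (mono_tags) mem_Collect_eq rees_algebra_simps(1))
      ultimately show ?thesis using P_Suc_colon_p by blast
    qed
    then obtain s where s: "\<And>i. poly.coeff f i = u * s i" "\<And>i. s i \<in> P i" by metis
    obtain h where h: "f = h * [:u:]"
    proof -
      have "[:u:] dvd f" unfolding const_poly_dvd_iff using s(1) by simp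
      then show ?thesis using that by (metis dvdE mult.commute)
    qed
    have "poly.coeff h i = s i" for i
      using s(1)[of i] u_neq_0 unfolding h by simp
    then have "h \<in> carrier S" using s(2) by simp
    then show ?thesis unfolding Idl1 h by blast
  qed
  moreover have "a = 0" if "[:u:] * a \<in> Idl\<^bsub>S\<^esub> {}" for a
    using that u_neq_0 unfolding Idl0 by simp
  ultimately show ?thesis
    unfolding regular_sequence_def
    using const_in_S[of u] monom_p_in_S u_monom_p_proper Idl0
    by (auto simp: less_Suc_eq simp del: rees_algebra_simps(1))
qed

lemma rees_almost_cohen_macaulay_I: "rees_almost_cohen_macaulay I"
proof -
  interpret S: cring S by (rule cring_rees_algebra[OF ideal_I])
  let ?G = "{[:var_x:], [:var_y:]} \<union> {Polynomial.monom a 1 |a. a \<in> I}"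
  have G: "?G \<subseteq> carrier S" using const_in_S monom_in_S by blast
  interpret M: ideal "rees_max_ideal I" S
    unfolding rees_max_ideal_def by (rule S.genideal_ideal[OF G])
  have GM: "?G \<subseteq> rees_max_ideal I"
    unfolding rees_max_ideal_def by (rule S.genideal_self[OF G])
  obtain w1 w2 where "u = var_x * w1 + var_y * w2"
    using var_decomposition_is_form[OF form_u] by (elim exE conjE) (rule that)
  then have "[:u:] = [:w1:] * [:var_x:] + [:w2:] * [:var_y:]" by (simp add: mult.commute)
  moreover have "[:w1:] * [:var_x:] + [:w2:] * [:var_y:] \<in> rees_max_ideal I"
    using M.a_closed[OF M.I_l_closed[OF _ const_in_S[of w1]] M.I_l_closed[OF _ const_in_S[of w2]],
        of "[:var_x:]" "[:var_y:]"] GM by simp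
  ultimately have "[:u:] \<in> rees_max_ideal I" by simp
  moreover have "Polynomial.monom p 1 \<in> rees_max_ideal I"
    using GM p_in_J J_subset_I by blast
  ultimately have "enat (length [[:u:], Polynomial.monom p 1]) \<le> depth_wrt S (rees_max_ideal I)"
    unfolding depth_wrt_def
    by (intro Sup_upper CollectI exI[of _ "[[:u:], Polynomial.monom p 1]"] conjI refl
        regular_sequence_u_monom_p) simp
  then show ?thesis
    by (simp add: rees_almost_cohen_macaulay_def numeral_eq_enat numeral_2_eq_2)
qed

end

section \<open>Reduction of the Hilbert-Burch matrix\<close>

text \<open>As \<open>d\<close> is a unit, \<open>f\<close> and \<open>u * q\<close> are
  interchangeable modulo \<open>p\<close>, and \<open>g\<close> and \<open>v * q\<close> are so
  modulo \<open>p\<close> and \<open>f\<close>. The names are neutral because either of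
  \<open>f1\<close>, \<open>f2\<close> may serve as \<open>p\<close>.\<close>

lemma linear_column_change_generators:
  assumes uv: "linear_coordinates u v" and n: "n > 0"
    and p: "is_form n p" "p \<noteq> 0" and q: "is_form (n - 1) q"
    and cop: "\<And>w. p dvd f * w \<Longrightarrow> p dvd w"
    and uq: "u * q = c * p + d * f" and d: "d dvd 1" and g: "g = a * p + b * f + v * q"
  shows "linear_column u v p q n"
    and "Idl\<^bsub>Rxy\<^esub> {p, f, g} = Idl\<^bsub>Rxy\<^esub> {p, u * q, v * q}"
    and "Idl\<^bsub>Rxy\<^esub> {p, f} = Idl\<^bsub>Rxy\<^esub> {p, u * q}"
proof -
  interpret linear_coordinates u v by fact
  obtain e where e: "1 = d * e" using d by (rule dvdE)
  have f: "f = e * (u * q) - e * c * p"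
  proof -
    have "e * (u * q) - e * c * p = d * e * f" unfolding uq by (simp add: algebra_simps)
    then show ?thesis using e by simp
  qed
  show "linear_column u v p q n"
  proof
    show "p dvd w" if "p dvd u * q * w" for w
    proof -
      have "p dvd u * q * w - p * (c * w)" using that by (intro dvd_diff dvd_triv_left)
      also have "u * q * w - p * (c * w) = f * (d * w)" unfolding uq by (simp add: algebra_simps)
      finally have "p dvd d * w" by (rule cop)
      then have "p dvd e * (d * w)" by (rule dvd_mult)
      also have "e * (d * w) = d * e * w" by (simp add: mult_ac)
      finally show ?thesis using e by simp
    qed
  qed (use n p q in auto)
  have add: "x + y \<in> Idl\<^bsub>Rxy\<^esub> T" if "x \<in> Idl\<^bsub>Rxy\<^esub> T" "y \<in> Idl\<^bsub>Rxy\<^esub> T" for x y and T :: "'a poly poly set"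
    using ideal_add[OF ideal_genideal that] .
  have mult: "r * x \<in> Idl\<^bsub>Rxy\<^esub> T" if "x \<in> Idl\<^bsub>Rxy\<^esub> T" for r x and T :: "'a poly poly set"
    using ideal_mult[OF ideal_genideal that] .
  have diff: "x - y \<in> Idl\<^bsub>Rxy\<^esub> T" if "x \<in> Idl\<^bsub>Rxy\<^esub> T" "y \<in> Idl\<^bsub>Rxy\<^esub> T" for x y and T :: "'a poly poly set"
    using ideal_diff[OF ideal_genideal that] .
  have self: "x \<in> Idl\<^bsub>Rxy\<^esub> T" if "x \<in> T" for x and T :: "'a poly poly set"
    using genideal_superset that by blast
  have uq_mem: "u * q \<in> Idl\<^bsub>Rxy\<^esub> T" if "p \<in> T" "f \<in> T" for T
    unfolding uq using that by (intro add mult self)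
  have f_mem: "f \<in> Idl\<^bsub>Rxy\<^esub> T" if "p \<in> T" "u * q \<in> T" for T
    by (subst f) (use that in \<open>intro diff mult self\<close>)
  show "Idl\<^bsub>Rxy\<^esub> {p, f} = Idl\<^bsub>Rxy\<^esub> {p, u * q}"
    using uq_mem[of "{p, f}"] f_mem[of "{p, u * q}"] self
    by (intro antisym genideal_least ideal_genideal) auto
  have vq: "v * q = g - a * p - b * f" unfolding g by simp
  have "v * q \<in> Idl\<^bsub>Rxy\<^esub> {p, f, g}"
    unfolding vq by (intro diff mult self) auto
  moreover have "g \<in> Idl\<^bsub>Rxy\<^esub> {p, u * q, v * q}"
    unfolding g by (intro add mult self f_mem) auto
  ultimately show "Idl\<^bsub>Rxy\<^esub> {p, f, g} = Idl\<^bsub>Rxy\<^esub> {p, u * q, v * q}"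
    using uq_mem[of "{p, f, g}"] f_mem[of "{p, u * q, v * q}"] self
    by (intro antisym genideal_least ideal_genideal) auto
qed

lemma row_minor_eq: "row_minor \<phi> i j = \<phi> $ i $ 1 * \<phi> $ j $ 2 - \<phi> $ i $ 2 * \<phi> $ j $ 1"
  by (simp add: row_minor_def det_2)

text \<open>Regularity of \<open>f1\<close>, \<open>f2\<close> ensures that the third entry of the
  linear column is nonzero, that the other two are not both multiples of it, and that the new
  generators of \<open>J\<close> stay coprime.\<close>

lemma linear_column_reduction:
  fixes \<phi> :: "'k::field poly poly^2^3"
  assumes n: "n \<ge> 2" and lin: "\<And>i. is_form 1 (\<phi> $ i $ 1)" and form: "\<And>i. is_form (n - 1) (\<phi> $ i $ 2)"
    and f: "f1 = row_minor \<phi> 2 3" "f2 = row_minor \<phi> 1 3" "f3 = row_minor \<phi> 1 2"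
    and reg: "regular_sequence Rxy [f1, f2]"
  shows "\<exists>u v p q. linear_column u v p q n \<and>
    Idl\<^bsub>Rxy\<^esub> {f1, f2, f3} = Idl\<^bsub>Rxy\<^esub> {p, u * q, v * q} \<and> Idl\<^bsub>Rxy\<^esub> {f1, f2} = Idl\<^bsub>Rxy\<^esub> {p, u * q}"
proof -
  define \<alpha> where "\<alpha> i = \<phi> $ i $ 1" for i
  define \<beta> where "\<beta> i = \<phi> $ i $ 2" for i
  define u where "u = \<alpha> 3"
  have f1: "f1 = \<alpha> 2 * \<beta> 3 - \<beta> 2 * u" and f2: "f2 = \<alpha> 1 * \<beta> 3 - \<beta> 1 * u"
    and f3: "f3 = \<alpha> 1 * \<beta> 2 - \<beta> 1 * \<alpha> 2"
    by (simp_all add: f row_minor_eq \<alpha>_def \<beta>_def u_def)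
  have \<alpha>: "is_form (Suc 0) (\<alpha> i)" and \<beta>: "is_form (n - 1) (\<beta> i)" for i
    using lin form by (simp_all add: \<alpha>_def \<beta>_def)
  have form_f: "is_form n f1" "is_form n f2"
    using is_form_mult[OF \<alpha> \<beta>] is_form_mult[OF \<beta> \<alpha>] n
    by (simp_all add: f1 f2 u_def is_form_diff)
  have f1_0: "f1 \<noteq> 0"
  proof
    assume "f1 = 0"
    moreover have "f1 * 1 \<in> Idl\<^bsub>Rxy\<^esub> {} \<longrightarrow> (1 :: 'k poly poly) \<in> Idl\<^bsub>Rxy\<^esub> {}"
      using reg[unfolded regular_sequence_def, THEN conjunct2, THEN conjunct1, rule_format, of 0 1] by auto
    ultimately show False by (simp add: genideal_empty)
  qed
  have cop: "f1 dvd w" if "f1 dvd f2 * w" for w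
  proof -
    have "\<forall>a. f2 * a \<in> Idl\<^bsub>Rxy\<^esub> {f1} \<longrightarrow> a \<in> Idl\<^bsub>Rxy\<^esub> {f1}"
      using reg[unfolded regular_sequence_def, THEN conjunct2, THEN conjunct1, rule_format, of 1] by simp
    then show ?thesis using that by (auto simp: mem_genideal_singleton dvd_def)
  qed
  have nonunit: "\<not> g dvd 1" if "order_ge (Suc 0) g" for g :: "'k poly poly"
    using not_order_ge_1_one order_ge_mult_left[OF that] by (metis dvdE mult.commute)
  have f2_0: "f2 \<noteq> 0"
  proof
    assume "f2 = 0"
    then have "f1 dvd 1" using cop[of 1] by simp
    moreover have "order_ge (Suc 0) f1"
      using order_ge_mono[OF is_form_imp_order_ge[OF form_f(1)]] n by simp
    ultimately show False using nonunit by blast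
  qed
  have cop': "f2 dvd w" if "f2 dvd f1 * w" for w
    using dvd_mult_symmetric[OF f1_0 cop that] .
  \<comment> \<open>A common factor is a unit: \<open>f1\<close> divides \<open>f2 * t1\<close>,
    hence \<open>t1\<close>, and \<open>f1\<close> can be cancelled.\<close>
  have no_common: "s dvd 1" if "f1 = s * t1" "f2 = s * t2" for s t1 t2
  proof -
    have "f1 dvd f2 * t1" unfolding that by (simp add: mult_ac)
    then have "f1 dvd t1" by (rule cop)
    then obtain r where "t1 = f1 * r" by (rule dvdE)
    then have "f1 * 1 = f1 * (s * r)" using that(1) by (simp add: mult_ac)
    then have "1 = s * r" using f1_0 by (metis mult_left_cancel)
    then show ?thesis by (rule dvdI)
  qed
  \<comment> \<open>Otherwise \<open>\<beta> 3\<close> would be a common factor of \<open>f1\<close>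
    and \<open>f2\<close>, and it is no unit because \<open>n - 1\<close> is positive.\<close>
  have u0: "u \<noteq> 0"
  proof
    assume "u = 0"
    then have "\<beta> 3 dvd 1" using no_common[of "\<beta> 3" "\<alpha> 2" "\<alpha> 1"] f1 f2 by (simp add: mult.commute)
    moreover have "order_ge (Suc 0) (\<beta> 3)"
      using order_ge_mono[OF is_form_imp_order_ge[OF \<beta>]] n by simp
    ultimately show False using nonunit by blast
  qed
  obtain v where uv: "linear_coordinates u v"
    using linear_coordinates_exist[OF _ u0] \<alpha> u_def by blast
  interpret linear_coordinates u v by fact
  have "\<exists>a b. \<alpha> i = [:[:a:]:] * u + [:[:b:]:] * v" for i
  proof -
    obtain w1 w2 where w: "\<alpha> i = u * w1 + v * w2" "is_form 0 w1" "is_form 0 w2"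
      using decomposition_is_form[OF \<alpha>[of i]] by (elim exE conjE) (rule that)
    obtain a b where "w1 = [:[:a:]:]" "w2 = [:[:b:]:]" using is_form_0_imp_const w by metis
    then show ?thesis using w(1) by (metis mult.commute)
  qed
  then obtain a b where ab: "\<And>i. \<alpha> i = [:[:a i:]:] * u + [:[:b i:]:] * v" by metis
  define A where "A i = [:[:a i:]:]" for i
  define B where "B i = [:[:b i:]:]" for i
  have AB: "\<alpha> i = A i * u + B i * v" for i using ab by (simp only: A_def B_def)
  \<comment> \<open>In \<open>B 2 * f2 - B 1 * f1\<close> the terms in \<open>v * \<beta> 3\<close>
    cancel, and \<open>q\<close> is the cofactor of \<open>u\<close> in what remains.\<close>
  define q where "q = (B 2 * A 1 - B 1 * A 2) * \<beta> 3 + B 1 * \<beta> 2 - B 2 * \<beta> 1"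
  have form_q: "is_form (n - 1) q"
  proof -
    have AA: "B 2 * A 1 - B 1 * A 2 = [:[:b 2 * a 1 - b 1 * a 2:]:]" by (simp add: A_def B_def)
    show ?thesis
      unfolding q_def AA unfolding B_def
      by (intro is_form_add is_form_diff is_form_const_mult \<beta>)
  qed
  have uq: "u * q = - B 1 * f1 + B 2 * f2"
    unfolding q_def f1 f2 AB[of 1] AB[of 2] by (simp add: algebra_simps)
  \<comment> \<open>Here the terms in \<open>u\<close> of \<open>f3 + A 1 * f1 - A 2 * f2\<close>
    cancel, leaving \<open>v\<close> times the same \<open>q\<close>.\<close>
  have g: "f3 = - A 1 * f1 + A 2 * f2 + v * q"
    unfolding q_def f1 f2 f3 AB[of 1] AB[of 2] by (simp add: algebra_simps)
  have unit: "B i dvd 1" if "b i \<noteq> 0" for i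
  proof -
    have "1 = B i * [:[:inverse (b i):]:]" using that by (simp add: B_def pCons_one)
    then show ?thesis by (rule dvdI)
  qed
  have n0: "n > 0" using n by simp
  show ?thesis
  \<comment> \<open>If \<open>b 2\<close> is nonzero, \<open>f2\<close> is traded for
    \<open>u * q\<close> and \<open>f1\<close> serves as \<open>p\<close>. Otherwise
    \<open>b 1\<close> is nonzero, as \<open>u\<close> would divide both minors, and the roles are
    swapped.\<close>
  proof (cases "b 2 = 0")
    case False
    show ?thesis
      using linear_column_change_generators[OF uv n0 form_f(1) f1_0 form_q cop uq unit[OF False] g]
      by blast
  next
    case b2: True
    have "b 1 \<noteq> 0"
    proof
      assume "b 1 = 0"
      with b2 have "f1 = u * (A 2 * \<beta> 3 - \<beta> 2)" "f2 = u * (A 1 * \<beta> 3 - \<beta> 1)"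
        unfolding f1 f2 AB[of 1] AB[of 2] by (simp_all add: B_def algebra_simps)
      then show False using no_common u_nonunit by blast
    qed
    then have unit': "- B 1 dvd 1" using unit by simp
    have uq': "u * q = B 2 * f2 + - B 1 * f1" and g': "f3 = A 2 * f2 + - A 1 * f1 + v * q"
      using uq g by simp_all
    show ?thesis
      using linear_column_change_generators[OF uv n0 form_f(2) f2_0 form_q cop' uq' unit' g']
      unfolding insert_commute[of f1 f2] by blast
  qed
qed

theorem proposition4p6:
  fixes \<phi> :: "'k::field poly poly^2^3"
    and f1 f2 f3 :: "'k poly poly"
    and I J :: "'k poly poly set"
    and F :: "nat \<Rightarrow> ('k poly poly, 'k poly poly set) module"
    and n :: nat
  assumes "n \<ge> 2"
    and "\<And>i. is_form 1 (\<phi> $ i $ 1)"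
    and "\<And>i. is_form (n - 1) (\<phi> $ i $ 2)"
    and "f1 = row_minor \<phi> 2 3"
    and "f2 = row_minor \<phi> 1 3"
    and "f3 = row_minor \<phi> 1 2"
    and "I = Idl\<^bsub>Rxy\<^esub> {f1, f2, f3}"
    and "ideal_codim Rxy I = 2"
    and "regular_sequence Rxy [f1, f2]"
    and "J = Idl\<^bsub>Rxy\<^esub> {f1, f2}"
    and "\<And>j. F j = quotient_module (ideal_as_module Rxy (ideal_power Rxy I j))
                                (J \<cdot>\<^bsub>Rxy\<^esub> ideal_power Rxy I (j - 1))"
  shows "(\<forall>j. 1 \<le> j \<and> j \<le> n - 1 \<longrightarrow> module_length Rxy (F j) = enat (n - j)) \<and>
         rees_almost_cohen_macaulay I"
proof -
  obtain u v p q where "linear_column u v p q n"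
    and "Idl\<^bsub>Rxy\<^esub> {f1, f2, f3} = Idl\<^bsub>Rxy\<^esub> {p, u * q, v * q}"
    and "Idl\<^bsub>Rxy\<^esub> {f1, f2} = Idl\<^bsub>Rxy\<^esub> {p, u * q}"
    using linear_column_reduction[OF assms(1-6,9)] by (elim exE conjE) (rule that)
  then have I: "I = Idl\<^bsub>Rxy\<^esub> {p, u * q, v * q}" and J: "J = Idl\<^bsub>Rxy\<^esub> {p, u * q}"
    by (simp_all only: assms(7,10))
  interpret linear_column u v p q n by fact
  show ?thesis
  proof (intro conjI allI impI)
    fix j assume j: "1 \<le> j \<and> j \<le> n - 1"
    then obtain k where "j = Suc k" by (cases j) auto
    with j show "module_length Rxy (F j) = enat (n - j)"
      using module_length_fiber[of k] by (simp add: assms(11) I J)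
  qed (simp only: I rees_almost_cohen_macaulay_I)
qed

end
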